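(* Let $a>0$ and $b:=a/2$. Let $f_1,f_2\in L^1(\mathbb{R}^2)$ be continuous functions. Let $m\in\mathbb{Z}$ and let $n\ge|m|$ be an integer with $n-|m|$ even. Then $$C_{n,m}^a(f_1\circledast f_2)=\sum_{\mathbf{k}\in\mathbb{Z}^2}c_a(\mathbf{k};n,m)\,\widehat{f_1}[\mathbf{k}]\,\widehat{f_2}[\mathbf{k}],$$ where, for $j\in\{1,2\}$ and $\mathbf{k}=(k_1,k_2)^T\in\mathbb{Z}^2$, $$\widehat{f_j}[\mathbf{k}]:=\int_0^b\int_0^{2\pi}f_j(r,\theta)e^{-\pi \mathrm{i} a^{-1}r(k_1\cos\theta+k_2\sin\theta)}\,r\,d\theta\,dr.$$
   Context: $\mathbb{B}_a^2=\{\mathbf{x}\in\mathbb{R}^2:\|\mathbf{x}\|_2\le a\}$. For continuous $f_j$, let $R(f_j)$ be the restriction of $f_j$ to $\mathbb{B}_b^2$ and $E(f_j)$ the extension of $R(f_j)$ by zero (equal to $f_j$ on $\mathbb{B}_b^2$ and $0$ elsewhere, on $\Omega_a=[-a,a]^2$ and on all of $\mathbb{R}^2$). The windowed convolution is $f_1\circledast f_2:=E(f_1)\ast E(f_2)$, where $g_1\ast g_2(\mathbf{x})=\int_{\mathbb{R}^2}g_1(\mathbf{y})g_2(\mathbf{x}-\mathbf{y})\,d\mathbf{y}$; it is supported in $\mathbb{B}_a^2$. $f(r,\theta)$ denotes $f$ in polar coordinates. $J_q$ is the Bessel function of the first kind of integer order $q$. For $m\in\mathbb{Z}$ and an integer $n\ge|m|$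 with $n-|m|$ even, $$Z_{nm}(r)=\sum_{j=0}^{\frac{n-|m|}{2}}(-1)^j\frac{(n-j)!}{j!\,(\frac{n+|m|}{2}-j)!\,(\frac{n-|m|}{2}-j)!}r^{n-2j},\qquad V_{nm}^a(r,\theta)=a^{-1}\sqrt{\tfrac{n+1}{\pi}}\,Z_{nm}(a^{-1}r)\,e^{\mathrm{i} m\theta},$$ and $C_{n,m}^a(f)=\int_0^a\int_0^{2\pi}f(r,\theta)\overline{V_{nm}^a(r,\theta)}\,r\,d\theta\,dr$. For $\mathbf{k}=(k_1,k_2)^T\in\mathbb{Z}^2$, $|\mathbf{k}|=\sqrt{k_1^2+k_2^2}$, $\Phi(\mathbf{k})\in[0,2\pi)$ is the polar angle ($k_1=|\mathbf{k}|\cos\Phi(\mathbf{k})$, $k_2=|\mathbf{k}|\sin\Phi(\mathbf{k})$, with $\Phi(\mathbf{0})=0$), and $$c_a(\mathbf{k};n,m)=\sqrt{n+1}\,\frac{\mathrm{i}^m(-1)^{\frac{n-m}{2}}J_{n+1}(\pi|\mathbf{k}|)}{2a\sqrt{\pi}\,|\mathbf{k}|}\,e^{-\mathrm{i} m\Phi(\mathbf{k})},$$ where at $\mathbf{k}=\mathbf{0}$ the quotient $J_{n+1}(\pi|\mathbf{k}|)/|\mathbf{k}|$ is understood as its limit as $|\mathbf{k}|\to0$ ($\pi/2$ if $n=0$, $0$ if $n\ge1$). *)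

theory Defs
  imports "HOL-Analysis.Analysis"
begin

text \<open>
  The terms with \<open>q + j < 0\<close> vanish, since \<open>rGamma\<close> is zero at the non-positive integers; so
  the series is the usual one for every integer order, negative orders included.
\<close>

definition bessel_J :: "int \<Rightarrow> real \<Rightarrow> real" where
  "bessel_J q x =
     (\<Sum>j. (- 1) ^ j * rGamma (real_of_int q + real j + 1) / fact j
           * (x / 2) powi (2 * int j + q))"

definition extend_by_zero :: "real \<Rightarrow> (real ^ 2 \<Rightarrow> complex) \<Rightarrow> real ^ 2 \<Rightarrow> complex" where
  "extend_by_zero b f x = (if x \<in> cball 0 b then f x else 0)"

definition convolution ::
    "(real ^ 2 \<Rightarrow> complex) \<Rightarrow> (real ^ 2 \<Rightarrow> complex) \<Rightarrow> real ^ 2 \<Rightarrow> complex" where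
  "convolution g1 g2 x = (LINT y|lborel. g1 y * g2 (x - y))"

definition windowed_convolution ::
    "real \<Rightarrow> (real ^ 2 \<Rightarrow> complex) \<Rightarrow> (real ^ 2 \<Rightarrow> complex) \<Rightarrow> real ^ 2 \<Rightarrow> complex" where
  "windowed_convolution b f1 f2 = convolution (extend_by_zero b f1) (extend_by_zero b f2)"

definition polar :: "real \<Rightarrow> real \<Rightarrow> real ^ 2" where
  "polar r \<theta> = vector [r * cos \<theta>, r * sin \<theta>]"

text \<open>
  The Zernike definitions are meant for \<open>\<bar>m\<bar> \<le> n\<close> with \<open>n - \<bar>m\<bar>\<close> even; then all divisions by 2
  are exact and none of the subtractions on \<^typ>\<open>nat\<close> truncates.
\<close>

definition zernike_radial :: "nat \<Rightarrow> int \<Rightarrow> real \<Rightarrow> real" where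
  "zernike_radial n m r =
     (\<Sum>j = 0..(n - nat \<bar>m\<bar>) div 2.
        (- 1) ^ j * fact (n - j)
        / (fact j * fact ((n + nat \<bar>m\<bar>) div 2 - j) * fact ((n - nat \<bar>m\<bar>) div 2 - j))
        * r ^ (n - 2 * j))"

definition zernike :: "real \<Rightarrow> nat \<Rightarrow> int \<Rightarrow> real \<Rightarrow> real \<Rightarrow> complex" where
  "zernike a n m r \<theta> =
     of_real (inverse a * sqrt ((real n + 1) / pi) * zernike_radial n m (inverse a * r))
     * exp (\<i> * of_int m * of_real \<theta>)"

definition zernike_coeff :: "real \<Rightarrow> nat \<Rightarrow> int \<Rightarrow> (real ^ 2 \<Rightarrow> complex) \<Rightarrow> complex" where
  "zernike_coeff a n m f =
     (LBINT r:{0..a}. (LBINT \<theta>:{0..2*pi}.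
        f (polar r \<theta>) * cnj (zernike a n m r \<theta>) * of_real r))"

definition lattice_norm :: "int \<times> int \<Rightarrow> real" where
  "lattice_norm k = sqrt ((real_of_int (fst k))\<^sup>2 + (real_of_int (snd k))\<^sup>2)"

text \<open>\<^const>\<open>Arg2pi\<close> takes values in \<open>[0, 2\<pi>)\<close>, and \<open>Arg2pi 0 = 0\<close>.\<close>

definition lattice_angle :: "int \<times> int \<Rightarrow> real" where
  "lattice_angle k = Arg2pi (Complex (real_of_int (fst k)) (real_of_int (snd k)))"

text \<open>The limit at \<open>0\<close> is \<open>\<pi>/2\<close> for \<open>n = 0\<close> and \<open>0\<close> for \<open>n \<ge> 1\<close>.\<close>

definition bessel_quotient :: "nat \<Rightarrow> real \<Rightarrow> real" where
  "bessel_quotient n s =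
     (if s = 0 then Lim (at_right 0) (\<lambda>t. bessel_J (int n + 1) (pi * t) / t)
      else bessel_J (int n + 1) (pi * s) / s)"

definition c_coeff :: "real \<Rightarrow> int \<times> int \<Rightarrow> nat \<Rightarrow> int \<Rightarrow> complex" where
  "c_coeff a k n m =
     of_real (sqrt (real n + 1))
     * (\<i> powi m * (- 1) powi ((int n - m) div 2) * of_real (bessel_quotient n (lattice_norm k))
        / of_real (2 * a * sqrt pi))
     * exp (- \<i> * of_int m * of_real (lattice_angle k))"

definition windowed_fourier ::
    "real \<Rightarrow> real \<Rightarrow> (real ^ 2 \<Rightarrow> complex) \<Rightarrow> int \<times> int \<Rightarrow> complex" where
  "windowed_fourier a b f k =
     (LBINT r:{0..b}. (LBINT \<theta>:{0..2*pi}.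
        f (polar r \<theta>)
        * exp (- of_real pi * \<i> * of_real (inverse a) * of_real r
               * of_real (of_int (fst k) * cos \<theta> + of_int (snd k) * sin \<theta>))
        * of_real r))"

end

theory Submission
  imports Defs
begin

text \<open>
  Expand the windowed convolution \<open>h\<close> in a double Fourier series on the square \<open>[-a, a]\<^sup>2\<close> and
  integrate that series term by term against the conjugate Zernike function. Three facts make
  this work.

  First, the Fourier coefficients of \<open>h\<close> are the products \<open>F\<^sub>1[k] F\<^sub>2[k] / (4 a\<^sup>2)\<close> of the windowed
  Fourier coefficients. Both windows have radius \<open>a/2\<close>, so \<open>h\<close> vanishes outside the disc of radius
  \<open>a\<close>, hence outside the square, and its coefficients are Fourier integrals over the whole plane;
  there the convolution theorem (\<open>convolution_times_character\<close>) applies. Passing from the polar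
  integrals in the statement to integrals over the plane is \<open>integral_polar_coordinates\<close>.

  Second, \<open>h\<close> is equal to its Fourier series at every point of the square, and the series
  converges absolutely and uniformly. Each \<open>F\<^sub>j\<close> is square summable by Bessel's inequality
  (\<open>fourier_bessel_inequality\<close>), so the product is absolutely summable. Moreover \<open>h\<close> is continuous
  although the truncated factors are not (\<open>continuous_on_convolution\<close>), and it is periodic because
  it vanishes on the boundary of the square; so it is determined by its coefficients
  (\<open>fourier_series_of_summable_coeffs\<close>, by the Stone--Weierstrass theorem on the torus).

  Third, the Zernike coefficient of the plane wave with frequency \<open>k\<close> is \<open>4 a\<^sup>2 c\<^sub>a(k; n, m)\<close>
  (\<open>integral_fourier_char_zernike\<close>). Expand the
  plane wave \<open>exp (i z cos (\<theta> - \<Phi>))\<close> in powers of its exponent. The angular integral of a power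
  of the cosine against \<open>exp (- i m \<theta>)\<close> is a binomial coefficient, the radial integral of a power
  against \<open>Z\<^sub>n\<^sub>m\<close> is a quotient of factorials that vanishes for the powers below \<open>n\<close>
  (\<open>zernike_moment_sum\<close>), and what remains is the power series of \<open>J\<^sub>n\<^sub>+\<^sub>1(z)/z\<close>.
\<close>

section \<open>Interpolation and partial fractions\<close>

lemma lagrange_interpolation:
  fixes p :: "'a :: field poly" and x :: "'i \<Rightarrow> 'a"
  assumes "finite I" and inj: "inj_on x I" and deg: "degree p < card I"
  shows "poly p t = (\<Sum>i\<in>I. poly p (x i) * (\<Prod>l\<in>I - {i}. (t - x l) / (x i - x l)))"
proof -
  define q where "q = (\<Sum>i\<in>I. smult (poly p (x i) / (\<Prod>l\<in>I - {i}. x i - x l))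
                          (\<Prod>l\<in>I - {i}. [:- x l, 1:]))"
  have poly_q: "poly q u = (\<Sum>i\<in>I. poly p (x i) * (\<Prod>l\<in>I - {i}. (u - x l) / (x i - x l)))" for u
    by (simp add: q_def poly_sum poly_prod prod_dividef)
  have node: "poly q (x k) = poly p (x k)" if "k \<in> I" for k
  proof -
    have "(\<Prod>l\<in>I - {i}. (x k - x l) / (x i - x l)) = (if i = k then 1 else 0)" if "i \<in> I" for i
    proof (cases "i = k")
      case True
      have "(\<Prod>l\<in>I - {i}. (x k - x l) / (x i - x l)) = (\<Prod>l\<in>I - {i}. 1)"
        using inj that True by (intro prod.cong refl) (auto simp: inj_on_def)
      then show ?thesis using True by simp
    next
      case False
      then have "k \<in> I - {i}" using \<open>k \<in> I\<close> by auto
      then show ?thesis using False \<open>finite I\<close> by (auto simp: prod_zero_iff)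
    qed
    then have "poly q (x k) = (\<Sum>i\<in>I. poly p (x i) * (if i = k then 1 else 0))"
      unfolding poly_q by (intro sum.cong) auto
    also have "\<dots> = poly p (x k)"
      using \<open>finite I\<close> that by (simp add: if_distrib[of "(*) _"] sum.delta cong: if_cong)
    finally show ?thesis .
  qed
  have "degree q \<le> card I - 1"
    unfolding q_def
  proof (rule degree_sum_le)
    fix i assume "i \<in> I"
    have "degree (\<Prod>l\<in>I - {i}. [:- x l, 1:]) \<le> (\<Sum>l\<in>I - {i}. degree [:- x l, 1:])"
      using degree_prod_sum_le[of "I - {i}" "\<lambda>l. [:- x l, 1:]"] \<open>finite I\<close> by (simp add: o_def)
    also have "\<dots> = card I - 1" using \<open>i \<in> I\<close> by simp
    finally show "degree (smult (poly p (x i) / (\<Prod>l\<in>I - {i}. x i - x l))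
        (\<Prod>l\<in>I - {i}. [:- x l, 1:])) \<le> card I - 1"
      using degree_smult_le le_trans by blast
  qed (use assms in auto)
  then have "degree q < card I" using deg by linarith
  then have "p = q"
    using deg inj node by (intro poly_eqI_degree[of "x ` I"]) (auto simp: card_image)
  then show ?thesis using poly_q by metis
qed

text \<open>Divide the interpolation formula by the nodal polynomial.\<close>

lemma partial_fraction_expansion:
  fixes p :: "'a :: field poly" and x :: "'i \<Rightarrow> 'a"
  assumes "finite I" and "inj_on x I" and "degree p < card I" and t: "\<And>i. i \<in> I \<Longrightarrow> t \<noteq> x i"
  shows "poly p t / (\<Prod>i\<in>I. t - x i)
           = (\<Sum>i\<in>I. poly p (x i) / (\<Prod>l\<in>I - {i}. x i - x l) / (t - x i))"
proof -
  have nz: "(\<Prod>i\<in>I. t - x i) \<noteq> 0" using assms(1) t by (auto simp: prod_zero_iff)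
  have "poly p t / (\<Prod>i\<in>I. t - x i)
      = (\<Sum>i\<in>I. poly p (x i) * (\<Prod>l\<in>I - {i}. (t - x l) / (x i - x l)) / (\<Prod>i\<in>I. t - x i))"
    by (subst lagrange_interpolation[OF assms(1-3)]) (simp add: sum_divide_distrib)
  also have "\<dots> = (\<Sum>i\<in>I. poly p (x i) / (\<Prod>l\<in>I - {i}. x i - x l) / (t - x i))"
  proof (intro sum.cong refl)
    fix i assume i: "i \<in> I"
    have "(\<Prod>i\<in>I. t - x i) = (t - x i) * (\<Prod>l\<in>I - {i}. t - x l)"
      using assms(1) i by (simp add: prod.remove)
    moreover have "(\<Prod>l\<in>I - {i}. t - x l) \<noteq> 0" using assms(1) t by (auto simp: prod_zero_iff)
    ultimately show "poly p (x i) * (\<Prod>l\<in>I - {i}. (t - x l) / (x i - x l)) / (\<Prod>i\<in>I. t - x i)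
        = poly p (x i) / (\<Prod>l\<in>I - {i}. x i - x l) / (t - x i)"
      by (simp add: prod_dividef)
  qed
  finally show ?thesis .
qed

section \<open>Radial moments of the Zernike polynomials\<close>

lemma prod_index_differences:
  assumes "i \<le> N"
  shows "(\<Prod>l\<in>{..N} - {i}. real l - real i) = (- 1) ^ i * fact i * fact (N - i)"
proof -
  have "{..N} - {i} = {..<i} \<union> {i<..N}" using assms by auto
  then have "(\<Prod>l\<in>{..N} - {i}. real l - real i)
      = (\<Prod>l<i. real l - real i) * (\<Prod>l\<in>{i<..N}. real l - real i)"
    by (simp add: prod.union_disjoint disjoint_iff)
  also have "(\<Prod>l<i. real l - real i) = (\<Prod>k\<in>{1..i}. - real k)"
    by (rule prod.reindex_bij_witness[of _ "\<lambda>k. i - k" "\<lambda>l. i - l"]) (auto simp: of_nat_diff)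
  also have "\<dots> = (- 1) ^ i * fact i"
    using prod_uminus[of real "{1..i}"] by (simp add: fact_prod)
  also have "(\<Prod>l\<in>{i<..N}. real l - real i) = (\<Prod>k\<in>{1..N - i}. real k)"
    using assms by (intro prod.reindex_bij_witness[of _ "\<lambda>k. k + i" "\<lambda>l. l - i"]) (auto simp: of_nat_diff)
  also have "\<dots> = fact (N - i)" by (simp add: fact_prod)
  finally show ?thesis by simp
qed

lemma prod_consecutive_eq_fact_quotient:
  "(\<Prod>k<N. real (c + 1 + k)) = fact (c + N) / fact c"
proof (induction N)
  case (Suc N)
  have "(\<Prod>k<Suc N. real (c + 1 + k)) = fact (c + N) / fact c * real (Suc (c + N))"
    using Suc by simp
  then show ?case by (simp only: add_Suc_right fact_Suc) (simp add: mult_ac)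
qed simp

text \<open>
  The sum is a partial fraction expansion in \<open>t\<close>. The rational function
  \<open>t (t - 1) \<cdots> (t - N + 1) / ((t + M + 1) \<cdots> (t + M + N + 1))\<close> has its simple poles at
  \<open>- (M + 1 + i)\<close>, \<open>i \<le> N\<close>, and the residues there are, with \<open>i = N - j\<close>, the coefficients of the
  Zernike polynomial of degree \<open>M + 2 N\<close>. Its numerator vanishes for \<open>t < N\<close>: this is the
  orthogonality of the Zernike polynomial to the lower powers.
\<close>

lemma zernike_moment_sum:
  fixes M N t :: nat
  shows "(\<Sum>j\<le>N. (- 1) ^ j * fact (M + 2 * N - j) / (fact j * fact (M + N - j) * fact (N - j))
            / real (M + N - j + t + 1))
         = (if t < N then 0 else fact t * fact (t + M) / (fact (t - N) * fact (t + N + M + 1)))"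
proof -
  define p :: "real poly" where "p = (\<Prod>k<N. [:- real k, 1:])"
  define x where "x i = - real (M + 1 + i)" for i
  have poly_p: "poly p u = (\<Prod>k<N. u - real k)" for u by (simp add: p_def poly_prod)
  have "degree p \<le> (\<Sum>k<N. degree [:- real k, 1:])"
    using degree_prod_sum_le[of "{..<N}" "\<lambda>k. [:- real k, 1:]"] by (simp add: p_def o_def)
  then have deg: "degree p < card {..N}" by simp
  have px: "poly p (x i) = (- 1) ^ N * fact (M + N + i) / fact (M + i)" for i
  proof -
    have "poly p (x i) = (\<Prod>k<N. - real (M + i + 1 + k))"
      unfolding poly_p x_def by (intro prod.cong) auto
    also have "\<dots> = (- 1) ^ N * (\<Prod>k<N. real (M + i + 1 + k))"
      using prod_uminus[of "\<lambda>k. real (M + i + 1 + k)" "{..<N}"] by simp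
    finally show ?thesis
      using prod_consecutive_eq_fact_quotient[where c = "M + i" and N = N] by (simp add: ac_simps)
  qed
  have nodes: "(\<Prod>l\<in>{..N} - {i}. x i - x l) = (- 1) ^ i * fact i * fact (N - i)" if "i \<le> N" for i
    using prod_index_differences[OF that] by (simp add: x_def)
  have num: "poly p (real t) = (if t < N then 0 else fact t / fact (t - N))"
  proof (cases "t < N")
    case True
    then show ?thesis by (auto simp: poly_p prod_zero_iff)
  next
    case False
    have "poly p (real t) = (\<Prod>k<N. real (t - N + 1 + k))"
      unfolding poly_p using False
      by (intro prod.reindex_bij_witness[of _ "\<lambda>k. N - 1 - k" "\<lambda>k. N - 1 - k"]) (auto simp: of_nat_diff)
    then show ?thesis
      using prod_consecutive_eq_fact_quotient[where c = "t - N" and N = N] False by simp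
  qed
  have den: "(\<Prod>i\<le>N. real t - x i) = fact (t + N + M + 1) / fact (t + M)"
  proof -
    have "(\<Prod>i\<le>N. real t - x i) = (\<Prod>i<Suc N. real (t + M + 1 + i))"
      unfolding x_def lessThan_Suc_atMost by (intro prod.cong) auto
    then show ?thesis
      using prod_consecutive_eq_fact_quotient[where c = "t + M" and N = "Suc N"] by (simp add: ac_simps)
  qed
  have "(\<Sum>j\<le>N. (- 1) ^ j * fact (M + 2 * N - j) / (fact j * fact (M + N - j) * fact (N - j))
            / real (M + N - j + t + 1))
      = (\<Sum>i\<le>N. poly p (x i) / (\<Prod>l\<in>{..N} - {i}. x i - x l) / (real t - x i))"
  proof (rule sum.reindex_bij_witness[of _ "\<lambda>i. N - i" "\<lambda>j. N - j"])
    fix j assume "j \<in> {..N}"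
    then obtain i where N: "N = j + i" by (metis atMost_iff le_Suc_ex)
    have idx: "N - j = i" "M + N - j = M + i" "M + 2 * N - j = M + N + i" using N by auto
    have "poly p (x i) / (\<Prod>l\<in>{..N} - {i}. x i - x l) / (real t - x i)
        = (- 1) ^ N * (- 1) ^ i * fact (M + N + i) / (fact i * fact (M + i) * fact j) / real (M + i + t + 1)"
    proof -
      have "real t - x i = real (M + i + t + 1)" by (simp add: x_def)
      moreover have "(1 :: real) / (- 1) ^ i = (- 1) ^ i" by (simp add: minus_one_power_iff)
      moreover have "(\<Prod>l\<in>{..N} - {i}. x i - x l) = (- 1) ^ i * fact i * fact j"
        using nodes[of i] N by simp
      ultimately show ?thesis by (simp only: px) (simp add: minus_one_power_iff)
    qed
    also have "(- 1) ^ N * (- 1) ^ i = ((- 1) ^ j :: real)"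
      using N by (simp add: power_add)
    finally show "poly p (x (N - j)) / (\<Prod>l\<in>{..N} - {N - j}. x (N - j) - x l) / (real t - x (N - j))
        = (- 1) ^ j * fact (M + 2 * N - j) / (fact j * fact (M + N - j) * fact (N - j)) / real (M + N - j + t + 1)"
      using idx by (simp only: mult_ac)
  qed auto
  also have "\<dots> = poly p (real t) / (\<Prod>i\<le>N. real t - x i)"
    using deg by (intro partial_fraction_expansion[symmetric]) (auto simp: inj_on_def x_def)
  also have "\<dots> = (if t < N then 0 else fact t * fact (t + M) / (fact (t - N) * fact (t + N + M + 1)))"
    using num den by simp
  finally show ?thesis .
qed

text \<open>
  Only exponents of the form \<open>M + 2 t\<close> survive the angular integration, and for these the
  integrals of the monomials are half the simple fractions of \<open>zernike_moment_sum\<close>, up to a power of \<open>a\<close>.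
\<close>

lemma integral_zernike_radial_moment:
  fixes a :: real
  assumes "a > 0" and "\<bar>m\<bar> \<le> int n" and "even (int n - \<bar>m\<bar>)"
    and M: "M = nat \<bar>m\<bar>" and N: "N = (n - M) div 2"
  shows "integral {0..a} (\<lambda>r. zernike_radial n m (inverse a * r) * r ^ (M + 2 * t + 1))
         = (if t < N then 0
            else a ^ (M + 2 * t + 2) / 2 * (fact t * fact (t + M) / (fact (t - N) * fact (t + N + M + 1))))"
proof -
  have M': "int M = \<bar>m\<bar>" using M by simp
  then have "M \<le> n" using assms(2) by linarith
  with M' have "int (n - M) = int n - \<bar>m\<bar>" by linarith
  then have "even (n - M)" using assms(3) by (metis even_of_nat)
  then have n: "n = M + 2 * N" using N \<open>M \<le> n\<close> by auto
  define c :: "nat \<Rightarrow> real" where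
    "c j = (- 1) ^ j * fact (M + 2 * N - j) / (fact j * fact (M + N - j) * fact (N - j))" for j
  have Z: "zernike_radial n m x = (\<Sum>j\<le>N. c j * x ^ (n - 2 * j))" for x
    unfolding zernike_radial_def c_def M[symmetric]
    using n by (intro sum.cong) (auto simp: ac_simps)
  have "((\<lambda>r. c j * (inverse a * r) ^ (n - 2 * j) * r ^ (M + 2 * t + 1)) has_integral
         a ^ (M + 2 * t + 2) / 2 * (c j / real (M + N - j + t + 1))) {0..a}" if "j \<le> N" for j
  proof -
    define q where "q = n - 2 * j + (M + 2 * t + 1)"
    have q: "real (Suc q) = 2 * real (M + N - j + t + 1)" using that n by (auto simp: q_def)
    have "((\<lambda>r. r ^ q) has_integral a ^ Suc q / Suc q - 0 ^ Suc q / Suc q) {0..a}"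
    proof (rule fundamental_theorem_of_calculus)
      fix r :: real
      have "((\<lambda>r. r ^ Suc q / Suc q) has_real_derivative r ^ q) (at r within {0..a})"
        by (rule DERIV_cong[OF DERIV_cdivide[OF DERIV_pow]]) simp
      then show "((\<lambda>r. r ^ Suc q / Suc q) has_vector_derivative r ^ q) (at r within {0..a})"
        by (simp only: has_real_derivative_iff_has_vector_derivative)
    qed (use \<open>a > 0\<close> in simp)
    then have "((\<lambda>r. c j * inverse a ^ (n - 2 * j) * r ^ q) has_integral
        c j * inverse a ^ (n - 2 * j) * (a ^ Suc q / Suc q)) {0..a}"
      by (intro has_integral_mult_right) simp
    moreover have "c j * inverse a ^ (n - 2 * j) * (a ^ Suc q / Suc q)
        = a ^ (M + 2 * t + 2) / 2 * (c j / real (M + N - j + t + 1))"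
    proof -
      have "inverse a ^ (n - 2 * j) * a ^ Suc q = a ^ (M + 2 * t + 2)"
        using \<open>a > 0\<close> unfolding q_def by (simp add: power_add power_inverse field_simps)
      moreover have "c j * inverse a ^ (n - 2 * j) * (a ^ Suc q / Suc q)
          = c j / Suc q * (inverse a ^ (n - 2 * j) * a ^ Suc q)" by simp
      ultimately show ?thesis unfolding q by simp
    qed
    moreover have "(\<lambda>r. c j * inverse a ^ (n - 2 * j) * r ^ q)
        = (\<lambda>r. c j * (inverse a * r) ^ (n - 2 * j) * r ^ (M + 2 * t + 1))"
      unfolding q_def by (simp add: power_mult_distrib power_add mult_ac)
    ultimately show ?thesis by metis
  qed
  then have "((\<lambda>r. \<Sum>j\<le>N. c j * (inverse a * r) ^ (n - 2 * j) * r ^ (M + 2 * t + 1)) has_integral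
      (\<Sum>j\<le>N. a ^ (M + 2 * t + 2) / 2 * (c j / real (M + N - j + t + 1)))) {0..a}"
    by (intro has_integral_sum) auto
  then have "integral {0..a} (\<lambda>r. zernike_radial n m (inverse a * r) * r ^ (M + 2 * t + 1))
      = a ^ (M + 2 * t + 2) / 2 * (\<Sum>j\<le>N. c j / real (M + N - j + t + 1))"
    unfolding Z sum_distrib_right sum_distrib_left by (rule integral_unique)
  then show ?thesis
    unfolding c_def zernike_moment_sum by (cases "t < N") (simp_all only: if_True if_False mult_zero_right)
qed

section \<open>Integrals of exponentials and of powers of the cosine\<close>

lemma integral_cbox_product:
  fixes f g :: "real \<Rightarrow> complex"
  assumes f: "continuous_on {a..b} f" and g: "continuous_on {c..d} g"
  shows "integral (cbox (a, c) (b, d)) (\<lambda>p. f (fst p) * g (snd p)) = integral {a..b} f * integral {c..d} g"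
proof -
  have "continuous_on (cbox (a, c) (b, d)) (\<lambda>p. f (fst p) * g (snd p))"
    by (intro continuous_intros continuous_on_compose2[OF f] continuous_on_compose2[OF g])
       (auto simp: mem_box cbox_Pair_eq)
  then have "integral (cbox (a, c) (b, d)) (\<lambda>p. f (fst p) * g (snd p))
      = integral {a..b} (\<lambda>x. integral {c..d} (\<lambda>y. f x * g y))"
    by (subst integral_prod_continuous) (simp_all add: case_prod_beta)
  then show ?thesis by simp
qed

lemma integral_cis_int:
  fixes q :: int and L t0 :: real
  assumes "L > 0"
  shows "integral {t0..t0 + L} (\<lambda>t. cis (2 * pi / L * of_int q * t)) = (if q = 0 then of_real L else 0)"
proof (cases "q = 0")
  case False
  define w where "w = 2 * pi / L * of_int q"
  have w: "w \<noteq> 0" using False assms by (simp add: w_def)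
  have "((\<lambda>t. cis (w * t)) has_integral - \<i> / w * cis (w * (t0 + L)) - (- \<i> / w * cis (w * t0))) {t0..t0 + L}"
  proof (rule fundamental_theorem_of_calculus)
    fix t :: real
    have "((\<lambda>t. cis (w * t)) has_derivative (\<lambda>h. (h * w) *\<^sub>R (\<i> * cis (w * t)))) (at t)"
      by (auto intro!: derivative_eq_intros)
    then have "((\<lambda>t. cis (w * t)) has_vector_derivative w *\<^sub>R (\<i> * cis (w * t))) (at t)"
      by (simp add: has_vector_derivative_def)
    from has_vector_derivative_mult_right[OF this, of "- \<i> / w"]
    show "((\<lambda>t. - \<i> / w * cis (w * t)) has_vector_derivative cis (w * t)) (at t within {t0..t0 + L})"
      using w by - (rule has_vector_derivative_at_within, simp add: scaleR_conv_of_real)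
  qed (use assms in simp)
  moreover have "cis (w * (t0 + L)) = cis (w * t0)"
  proof -
    have "w * (t0 + L) = w * t0 + 2 * pi * of_int q" using assms by (simp add: w_def field_simps)
    then have "cis (w * (t0 + L)) = cis (w * t0) * cis (2 * pi * of_int q)" by (simp only: cis_mult)
    then show ?thesis by (simp only: cis_multiple_2pi Ints_of_int mult_1_right)
  qed
  ultimately show ?thesis using False by (simp add: w_def integral_unique)
qed (use assms in \<open>simp add: scaleR_conv_of_real\<close>)

text \<open>
  Write the cosine as a mean of two exponentials and expand by the binomial theorem: only the summand
  of frequency \<open>m\<close> survives the integration over a period.
\<close>

lemma integral_cos_power_cis:
  fixes m :: int and \<Phi> :: real
  shows "integral {0..2 * pi} (\<lambda>\<theta>. of_real (cos (\<theta> - \<Phi>)) ^ p * cis (- (of_int m * \<theta>)))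
         = (\<Sum>k\<le>p. if 2 * int k - int p = m then of_real (2 * pi / 2 ^ p * (p choose k)) * cis (- (of_int m * \<Phi>)) else 0)"
proof -
  define w :: "nat \<Rightarrow> int" where "w k = 2 * int k - int p" for k
  have cos: "complex_of_real (cos x) = (cis x + cis (- x)) / 2" for x
    by (simp add: complex_eq_iff)
  have pw: "complex_of_real (cos x) ^ p = (\<Sum>k\<le>p. of_nat (p choose k) / 2 ^ p * cis (of_int (w k) * x))" for x
  proof -
    have "cis x ^ k * cis (- x) ^ (p - k) = cis (of_int (w k) * x)" if k: "k \<le> p" for k
    proof -
      obtain l where "p = k + l" using le_Suc_ex[OF k] by blast
      moreover have "real k * x + real l * - x = of_int (w k) * x"
        using \<open>p = k + l\<close> by (simp add: w_def algebra_simps)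
      ultimately show ?thesis by (simp only: Complex.DeMoivre cis_mult add_diff_cancel_left')
    qed
    then have "(cis x + cis (- x)) ^ p = (\<Sum>k\<le>p. of_nat (p choose k) * cis (of_int (w k) * x))"
      unfolding binomial_ring by (intro sum.cong) (auto simp: mult.assoc)
    then show ?thesis unfolding cos power_divide by (simp add: sum_divide_distrib)
  qed
  have summand: "((\<lambda>\<theta>. of_nat (p choose k) / 2 ^ p * cis (of_int (w k) * (\<theta> - \<Phi>)) * cis (- (of_int m * \<theta>)))
      has_integral (if w k = m then of_real (2 * pi / 2 ^ p * (p choose k)) * cis (- (of_int m * \<Phi>)) else 0)) {0..2 * pi}" for k
  proof -
    have *: "(\<lambda>\<theta>. of_nat (p choose k) / 2 ^ p * cis (of_int (w k) * (\<theta> - \<Phi>)) * cis (- (of_int m * \<theta>)))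
      = (\<lambda>\<theta>. (of_nat (p choose k) / 2 ^ p * cis (- (of_int (w k) * \<Phi>))) * cis (2 * pi / (2 * pi) * of_int (w k - m) * \<theta>))"
    proof
      fix \<theta>
      have "of_int (w k) * (\<theta> - \<Phi>) + - (of_int m * \<theta>) = - (of_int (w k) * \<Phi>) + 2 * pi / (2 * pi) * of_int (w k - m) * \<theta>"
        by (simp add: algebra_simps)
      then show "of_nat (p choose k) / 2 ^ p * cis (of_int (w k) * (\<theta> - \<Phi>)) * cis (- (of_int m * \<theta>))
          = (of_nat (p choose k) / 2 ^ p * cis (- (of_int (w k) * \<Phi>))) * cis (2 * pi / (2 * pi) * of_int (w k - m) * \<theta>)"
        by (simp only: mult.assoc cis_mult)
    qed
    have "(\<lambda>\<theta>. cis (2 * pi / (2 * pi) * of_int (w k - m) * \<theta>)) integrable_on {0..2 * pi}"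
      by (intro integrable_continuous_interval continuous_intros)
    then have "((\<lambda>\<theta>. cis (2 * pi / (2 * pi) * of_int (w k - m) * \<theta>)) has_integral
        (if w k - m = 0 then of_real (2 * pi) else 0)) {0..2 * pi}"
      using integral_cis_int[of "2 * pi" 0 "w k - m"] by (simp add: has_integral_iff)
    from has_integral_mult_right[OF this, of "of_nat (p choose k) / 2 ^ p * cis (- (of_int (w k) * \<Phi>))"]
    show ?thesis unfolding * by (rule has_integral_eq_rhs) auto
  qed
  have "((\<lambda>\<theta>. of_real (cos (\<theta> - \<Phi>)) ^ p * cis (- (of_int m * \<theta>))) has_integral
     (\<Sum>k\<le>p. if w k = m then of_real (2 * pi / 2 ^ p * (p choose k)) * cis (- (of_int m * \<Phi>)) else 0)) {0..2 * pi}"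
    unfolding pw sum_distrib_right by (intro has_integral_sum summand) auto
  then show ?thesis by (simp add: integral_unique w_def)
qed

lemma integral_cos_power_cis_eq:
  fixes m :: int and \<Phi> :: real
  assumes "p = nat \<bar>m\<bar> + 2 * t"
  shows "integral {0..2 * pi} (\<lambda>\<theta>. of_real (cos (\<theta> - \<Phi>)) ^ p * cis (- (of_int m * \<theta>)))
         = of_real (2 * pi / 2 ^ p * (fact p / (fact t * fact (t + nat \<bar>m\<bar>)))) * cis (- (of_int m * \<Phi>))"
proof -
  \<comment> \<open>The only index with \<open>2 k - p = m\<close>; for negative \<open>m\<close> it is the mirror image, which gives the
      same binomial coefficient.\<close>
  define k where "k = (if m \<ge> 0 then t + nat \<bar>m\<bar> else t)"
  have k: "k \<le> p" "2 * int k' - int p = m \<longleftrightarrow> k' = k" for k' using assms by (auto simp: k_def)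
  have "real (p choose k) = fact p / (fact k * fact (p - k))" using k(1) by (rule binomial_fact)
  also have "\<dots> = fact p / (fact t * fact (t + nat \<bar>m\<bar>))" using assms by (auto simp: k_def ac_simps)
  finally have "real (p choose k) = fact p / (fact t * fact (t + nat \<bar>m\<bar>))" .
  then show ?thesis unfolding integral_cos_power_cis k(2) using k(1) by simp
qed

lemma integral_cos_power_cis_eq_0:
  fixes m :: int and \<Phi> :: real
  assumes "\<And>t. p \<noteq> nat \<bar>m\<bar> + 2 * t"
  shows "integral {0..2 * pi} (\<lambda>\<theta>. of_real (cos (\<theta> - \<Phi>)) ^ p * cis (- (of_int m * \<theta>))) = 0"
proof -
  have "2 * int k - int p \<noteq> m" if "k \<le> p" for k
  proof
    assume "2 * int k - int p = m"
    then have "p = nat \<bar>m\<bar> + 2 * (if m \<ge> 0 then p - k else k)" using that by auto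
    then show False using assms by blast
  qed
  then show ?thesis unfolding integral_cos_power_cis by (intro sum.neutral) auto
qed

section \<open>Termwise integration\<close>

text \<open>
  The Weierstrass test gives uniform convergence of the finite partial sums, and uniform limits commute
  with integration over a box. The index set is arbitrary so that the lemma serves both for power series
  and for Fourier series over pairs of integers.
\<close>

lemma has_sum_integral_cbox:
  fixes u :: "'i \<Rightarrow> 'b :: euclidean_space \<Rightarrow> 'c :: banach"
  assumes cont: "\<And>i. continuous_on (cbox a b) (u i)"
    and bound: "\<And>i x. x \<in> cbox a b \<Longrightarrow> norm (u i x) \<le> B i" and B: "B summable_on UNIV"
  shows "((\<lambda>i. integral (cbox a b) (u i)) has_sum integral (cbox a b) (\<lambda>x. \<Sum>\<^sub>\<infinity>i. u i x)) UNIV"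
    and "continuous_on (cbox a b) (\<lambda>x. \<Sum>\<^sub>\<infinity>i. u i x)"
proof -
  have lim: "uniform_limit (cbox a b) (\<lambda>X x. \<Sum>i\<in>X. u i x) (\<lambda>x. \<Sum>\<^sub>\<infinity>i. u i x) (finite_subsets_at_top UNIV)"
    using bound B by (intro Weierstrass_m_test_general) auto
  have sum_cont: "continuous_on (cbox a b) (\<lambda>x. \<Sum>i\<in>X. u i x)" for X
    by (intro continuous_intros cont)
  from uniform_limit_theorem[OF _ lim] sum_cont
  show "continuous_on (cbox a b) (\<lambda>x. \<Sum>\<^sub>\<infinity>i. u i x)" by (simp add: eventually_mono)
  obtain I J where I: "\<And>X. ((\<lambda>x. \<Sum>i\<in>X. u i x) has_integral I X) (cbox a b)"
    and J: "((\<lambda>x. \<Sum>\<^sub>\<infinity>i. u i x) has_integral J) (cbox a b)" and lim_I: "(I \<longlongrightarrow> J) (finite_subsets_at_top UNIV)"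
    by (rule uniform_limit_integral_cbox[OF lim sum_cont]) (auto simp: finite_subsets_at_top_neq_bot)
  have "eventually (\<lambda>X. I X = (\<Sum>i\<in>X. integral (cbox a b) (u i))) (finite_subsets_at_top UNIV)"
  proof (rule eventually_finite_subsets_at_top_weakI)
    fix X :: "'i set" assume "finite X"
    then show "I X = (\<Sum>i\<in>X. integral (cbox a b) (u i))"
      using cont by (intro has_integral_unique[OF I] has_integral_sum integrable_integral integrable_continuous)
  qed
  from tendsto_cong[THEN iffD1, OF this lim_I]
  show "((\<lambda>i. integral (cbox a b) (u i)) has_sum integral (cbox a b) (\<lambda>x. \<Sum>\<^sub>\<infinity>i. u i x)) UNIV"
    unfolding has_sum_def integral_unique[OF J] .
qed

section \<open>The Bessel quotient as a power series\<close>

lemma summable_bessel_series: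
  "summable (\<lambda>j. (- 1) ^ j / (fact j * fact (n + 1 + j)) * (x :: real) ^ j)"
proof (rule summable_comparison_test[OF exI, OF allI, OF impI])
  fix j :: nat
  have "\<bar>x\<bar> ^ j / (fact j * fact (n + 1 + j)) \<le> \<bar>x\<bar> ^ j / (fact j * 1)"
    by (intro divide_left_mono mult_left_mono mult_pos_pos fact_ge_1) simp_all
  then show "norm ((- 1) ^ j / (fact j * fact (n + 1 + j)) * x ^ j) \<le> \<bar>x\<bar> ^ j / fact j"
    by (simp add: abs_mult power_abs)
  show "summable (\<lambda>j. \<bar>x\<bar> ^ j / fact j)"
    using summable_exp[of "\<bar>x\<bar>"] by (simp add: field_simps)
qed

lemma bessel_J_Suc_eq:
  "bessel_J (int n + 1) x = (x / 2) ^ (n + 1) * (\<Sum>j. (- 1) ^ j / (fact j * fact (n + 1 + j)) * ((x / 2)\<^sup>2) ^ j)"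
proof -
  have "(- 1) ^ j * rGamma (real_of_int (int n + 1) + real j + 1) / fact j * (x / 2) powi (2 * int j + (int n + 1))
      = (x / 2) ^ (n + 1) * ((- 1) ^ j / (fact j * fact (n + 1 + j)) * ((x / 2)\<^sup>2) ^ j)" for j
  proof -
    have "Gamma (1 + real (n + 1 + j)) = fact (n + 1 + j)" by (rule Gamma_fact)
    then have "rGamma (real_of_int (int n + 1) + real j + 1) = 1 / fact (n + 1 + j)"
      by (simp add: rGamma_inverse_Gamma add_ac inverse_eq_divide)
    moreover have "(x / 2) powi (2 * int j + (int n + 1)) = (x / 2) ^ (2 * j + (n + 1))"
      using power_int_of_nat[of "x / 2" "2 * j + (n + 1)"] by (simp add: algebra_simps)
    moreover have "(x / 2) ^ (2 * j + (n + 1)) = (x / 2) ^ (n + 1) * ((x / 2)\<^sup>2) ^ j"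
      by (simp add: power_add power_mult)
    ultimately show ?thesis by (simp only:) (simp add: field_simps del: fact_Suc power_Suc)
  qed
  then show ?thesis
    unfolding bessel_J_def by (simp only: suminf_mult[OF summable_bessel_series])
qed

text \<open>
  One power series, continuous everywhere, represents \<open>J\<^sub>n\<^sub>+\<^sub>1(\<pi> s) / s\<close> for \<open>s \<noteq> 0\<close>; so it also gives
  the limit at \<open>0\<close>, and all frequencies are treated alike.
\<close>

lemma bessel_quotient_eq:
  "bessel_quotient n s = pi / 2 * (pi * s / 2) ^ n
     * (\<Sum>j. (- 1) ^ j / (fact j * fact (n + 1 + j)) * ((pi * s / 2)\<^sup>2) ^ j)"
    (is "_ = ?q s")
proof -
  \<comment> \<open>The factor \<open>(\<pi> t / 2) ^ (n + 1)\<close> of the Bessel function absorbs the division by \<open>t\<close>.\<close>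
  have quot: "bessel_J (int n + 1) (pi * t) / t = ?q t" if "t \<noteq> 0" for t
    using that by (simp add: bessel_J_Suc_eq)
  have "isCont ?q 0"
    by (intro continuous_intros isCont_o2[OF _ isCont_powser_converges_everywhere] summable_bessel_series)
       simp_all
  then have lim_q: "(?q \<longlongrightarrow> ?q 0) (at_right 0)"
    by (simp add: continuous_within filterlim_at_split isCont_def)
  have "eventually (\<lambda>t. bessel_J (int n + 1) (pi * t) / t = ?q t) (at_right 0)"
    using quot by (auto simp: eventually_at_right_field intro!: exI[of _ 1])
  from tendsto_cong[THEN iffD2, OF this lim_q] have "Lim (at_right 0) (\<lambda>t. bessel_J (int n + 1) (pi * t) / t) = ?q 0"
    by (intro tendsto_Lim) auto
  then show ?thesis using quot by (simp add: bessel_quotient_def)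
qed

section \<open>Zernike coefficients of plane waves\<close>

lemma cnj_zernike:
  "cnj (zernike a n m r \<theta>)
     = of_real (inverse a * sqrt ((real n + 1) / pi) * zernike_radial n m (inverse a * r)) * cis (- (of_int m * \<theta>))"
  by (simp add: zernike_def exp_cnj cis_conv_exp mult.assoc)

lemma continuous_on_zernike_radial [continuous_intros]:
  "continuous_on S f \<Longrightarrow> continuous_on S (\<lambda>x. zernike_radial n m (f x))"
  unfolding zernike_radial_def by (intro continuous_intros)

text \<open>
  The terms of the exponential series of a plane wave. Each integral splits into an angular and a radial
  factor. It vanishes unless the exponent is \<open>n + 2 j\<close>: otherwise the angular factor is zero (wrong
  parity, or exponent below \<open>\<bar>m\<bar>\<close>) or the radial one is (exponent between \<open>\<bar>m\<bar>\<close> and \<open>n\<close>). In the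
  remaining terms the factorials from the angular integral cancel against those of the radial moment
  and of the exponential series, leaving the coefficients of \<open>J\<^sub>n\<^sub>+\<^sub>1\<close>.
\<close>

lemma integral_zernike_cos_power:
  fixes a \<kappa> \<Phi> :: real
  assumes "a > 0" and m: "\<bar>m\<bar> \<le> int n" "even (int n - \<bar>m\<bar>)"
  defines "u \<equiv> \<lambda>p x. (\<i> * of_real (pi / a * fst x * \<kappa> * cos (snd x - \<Phi>))) ^ p / fact p
                      * (cnj (zernike a n m (fst x) (snd x)) * of_real (fst x))"
  shows "p \<notin> range (\<lambda>j. n + 2 * j) \<Longrightarrow> integral (cbox (0, 0) (a, 2 * pi)) (u p) = 0"
    and "integral (cbox (0, 0) (a, 2 * pi)) (u (n + 2 * j))
      = of_real (a * sqrt ((real n + 1) / pi) * pi) * \<i> ^ n * cis (- (of_int m * \<Phi>))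
        * of_real ((pi * \<kappa> / 2) ^ n * ((- 1) ^ j / (fact j * fact (n + 1 + j)) * ((pi * \<kappa> / 2)\<^sup>2) ^ j))"
proof -
  define M where "M = nat \<bar>m\<bar>"
  define N where "N = (n - M) div 2"
  have M': "int M = \<bar>m\<bar>" by (simp add: M_def)
  then have "M \<le> n" using m(1) by linarith
  with M' have "int (n - M) = int n - \<bar>m\<bar>" by linarith
  then have "even (n - M)" using m(2) by (metis even_of_nat)
  then have n: "n = M + 2 * N" using N_def \<open>M \<le> n\<close> by auto
  define K where "K = inverse a * sqrt ((real n + 1) / pi)"
  have split: "integral (cbox (0, 0) (a, 2 * pi)) (u p)
     = (\<i> * of_real (pi / a * \<kappa>)) ^ p / fact p * of_real K
       * of_real (integral {0..a} (\<lambda>r. zernike_radial n m (inverse a * r) * r ^ (p + 1)))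
       * integral {0..2 * pi} (\<lambda>\<theta>. of_real (cos (\<theta> - \<Phi>)) ^ p * cis (- (of_int m * \<theta>)))" for p
  proof -
    define C where "C = (\<i> * of_real (pi / a * \<kappa>)) ^ p / fact p * of_real K"
    have "u p = (\<lambda>x. (C * of_real (zernike_radial n m (inverse a * fst x) * fst x ^ (p + 1)))
                      * (of_real (cos (snd x - \<Phi>)) ^ p * cis (- (of_int m * snd x))))"
      unfolding u_def cnj_zernike C_def K_def
      by (rule ext) (simp add: power_mult_distrib power_divide mult_ac)
    then have "integral (cbox (0, 0) (a, 2 * pi)) (u p)
      = integral {0..a} (\<lambda>r. C * of_real (zernike_radial n m (inverse a * r) * r ^ (p + 1)))
        * integral {0..2 * pi} (\<lambda>\<theta>. of_real (cos (\<theta> - \<Phi>)) ^ p * cis (- (of_int m * \<theta>)))"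
      by (simp only:) (intro integral_cbox_product continuous_intros)
    also have "integral {0..a} (\<lambda>r. C * of_real (zernike_radial n m (inverse a * r) * r ^ (p + 1)))
      = C * of_real (integral {0..a} (\<lambda>r. zernike_radial n m (inverse a * r) * r ^ (p + 1)))"
    proof -
      have "(\<lambda>r. zernike_radial n m (inverse a * r) * r ^ (p + 1)) integrable_on {0..a}"
        by (intro integrable_continuous_interval continuous_intros)
      from has_integral_linear[OF integrable_integral[OF this] bounded_linear_of_real[where 'a = complex]]
      show ?thesis by (simp add: o_def integral_unique)
    qed
    finally show ?thesis by (simp add: C_def)
  qed
  show "integral (cbox (0, 0) (a, 2 * pi)) (u p) = 0" if p: "p \<notin> range (\<lambda>j. n + 2 * j)"
  proof (cases "\<exists>t. p = M + 2 * t")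
    case True
    then obtain t where t: "p = M + 2 * t" by blast
    have "t < N"
    proof (rule ccontr)
      assume "\<not> t < N"
      then have "p = n + 2 * (t - N)" using t n by simp
      then show False using p by blast
    qed
    then have "integral {0..a} (\<lambda>r. zernike_radial n m (inverse a * r) * r ^ (p + 1)) = 0"
      using integral_zernike_radial_moment[OF assms(1-3) M_def N_def, of t] unfolding t by simp
    then show ?thesis unfolding split by simp
  next
    case False
    then show ?thesis unfolding split using integral_cos_power_cis_eq_0[of p m] by (simp add: M_def)
  qed
  define p where "p = n + 2 * j"
  define t where "t = N + j"
  have p: "p = M + 2 * t" using n by (simp add: p_def t_def)
  have radial: "integral {0..a} (\<lambda>r. zernike_radial n m (inverse a * r) * r ^ (p + 1))
      = a ^ (p + 2) / 2 * (fact t * fact (t + M) / (fact j * fact (n + 1 + j)))"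
  proof -
    have "\<not> t < N" "t - N = j" "t + N + M + 1 = n + 1 + j" using n by (auto simp: t_def)
    then show ?thesis
      using integral_zernike_radial_moment[OF assms(1-3) M_def N_def, of t] unfolding p
      by (simp only: if_False)
  qed
  have angular: "integral {0..2 * pi} (\<lambda>\<theta>. of_real (cos (\<theta> - \<Phi>)) ^ p * cis (- (of_int m * \<theta>)))
      = of_real (2 * pi / 2 ^ p * (fact p / (fact t * fact (t + M)))) * cis (- (of_int m * \<Phi>))"
    using integral_cos_power_cis_eq[of p m t] p by (simp add: M_def)
  have "integral (cbox (0, 0) (a, 2 * pi)) (u p)
     = \<i> ^ p * cis (- (of_int m * \<Phi>)) * of_real ((pi / a * \<kappa>) ^ p / fact p * K
        * (a ^ (p + 2) / 2 * (fact t * fact (t + M) / (fact j * fact (n + 1 + j))))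
        * (2 * pi / 2 ^ p * (fact p / (fact t * fact (t + M)))))"
    unfolding split radial angular power_mult_distrib[of \<i>] by simp
  also have "(pi / a * \<kappa>) ^ p / fact p * K
        * (a ^ (p + 2) / 2 * (fact t * fact (t + M) / (fact j * fact (n + 1 + j))))
        * (2 * pi / 2 ^ p * (fact p / (fact t * fact (t + M))))
     = a * sqrt ((real n + 1) / pi) * pi * (pi * \<kappa> / 2) ^ p / (fact j * fact (n + 1 + j))"
  proof -
    define D :: real where "D = fact j * fact (n + 1 + j)"
    have "D \<noteq> 0" by (simp add: D_def)
    with \<open>a > 0\<close> show ?thesis unfolding D_def[symmetric]
      by (simp add: K_def power_mult_distrib power_divide power_add field_simps)
  qed
  also have "\<i> ^ p = \<i> ^ n * of_real ((- 1) ^ j)" by (simp add: p_def power_add power_mult)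
  also have "(pi * \<kappa> / 2) ^ p = (pi * \<kappa> / 2) ^ n * ((pi * \<kappa> / 2)\<^sup>2) ^ j"
    by (simp add: p_def power_add power_mult)
  finally show "integral (cbox (0, 0) (a, 2 * pi)) (u (n + 2 * j))
      = of_real (a * sqrt ((real n + 1) / pi) * pi) * \<i> ^ n * cis (- (of_int m * \<Phi>))
        * of_real ((pi * \<kappa> / 2) ^ n * ((- 1) ^ j / (fact j * fact (n + 1 + j)) * ((pi * \<kappa> / 2)\<^sup>2) ^ j))"
    unfolding p_def by (simp add: mult_ac)
qed

text \<open>
  Sum the terms of \<open>integral_zernike_cos_power\<close>; the exponential series converges uniformly on the disc.
\<close>

lemma integral_plane_wave_zernike:
  fixes a \<kappa> \<Phi> :: real
  assumes "a > 0" and m: "\<bar>m\<bar> \<le> int n" "even (int n - \<bar>m\<bar>)"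
  shows "integral (cbox (0, 0) (a, 2 * pi)) (\<lambda>x. cis (pi / a * fst x * \<kappa> * cos (snd x - \<Phi>))
            * (cnj (zernike a n m (fst x) (snd x)) * of_real (fst x)))
      = of_real (2 * a * sqrt ((real n + 1) / pi)) * \<i> ^ n * cis (- (of_int m * \<Phi>))
        * of_real (bessel_quotient n \<kappa>)"
proof -
  define w where "w x = cnj (zernike a n m (fst x) (snd x)) * complex_of_real (fst x)" for x
  define u where "u p x = (\<i> * of_real (pi / a * fst x * \<kappa> * cos (snd x - \<Phi>))) ^ p / fact p * w x" for p x
  have u_eq: "u p = (\<lambda>x. (\<i> * of_real (pi / a * fst x * \<kappa> * cos (snd x - \<Phi>))) ^ p / fact p
                      * (cnj (zernike a n m (fst x) (snd x)) * of_real (fst x)))" for p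
    by (rule ext) (simp only: u_def w_def)
  define c where "c = complex_of_real (a * sqrt ((real n + 1) / pi) * pi) * \<i> ^ n * cis (- (of_int m * \<Phi>))"
  let ?Q = "cbox (0, 0) (a, 2 * pi) :: (real \<times> real) set"
  have w: "continuous_on ?Q w"
    unfolding w_def cnj_zernike by (intro continuous_intros)
  obtain C where C: "\<And>x. x \<in> ?Q \<Longrightarrow> norm (w x) \<le> C"
    using compact_imp_bounded[OF compact_continuous_image[OF w compact_cbox]]
    by (auto simp: bounded_iff)
  have "(0, 0) \<in> ?Q" using \<open>a > 0\<close> by (simp add: cbox_Pair_eq)
  from C[OF this] have "C \<ge> 0" by (meson norm_ge_zero order_trans)
  have "continuous_on ?Q (u p)" for p
    unfolding u_def by (intro continuous_intros w) auto
  moreover have "norm (u p x) \<le> (pi * \<bar>\<kappa>\<bar>) ^ p / fact p * C" if "x \<in> ?Q" for p x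
  proof -
    have "\<bar>pi / a * fst x * \<kappa> * cos (snd x - \<Phi>)\<bar> \<le> pi / a * a * \<bar>\<kappa>\<bar> * 1"
      unfolding abs_mult using that \<open>a > 0\<close>
      by (intro mult_mono) (auto simp: cbox_Pair_eq)
    then have "\<bar>pi / a * fst x * \<kappa> * cos (snd x - \<Phi>)\<bar> ^ p \<le> (pi * \<bar>\<kappa>\<bar>) ^ p"
      using \<open>a > 0\<close> by (intro power_mono) auto
    moreover have "norm ((\<i> * of_real y) ^ p / fact p) = \<bar>y\<bar> ^ p / fact p" for y :: real
      by (simp add: norm_mult norm_divide norm_power)
    ultimately show ?thesis
      unfolding u_def norm_mult[of _ "w x"] using C[OF that] \<open>C \<ge> 0\<close>
      by (simp only:) (intro mult_mono divide_right_mono; simp)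
  qed
  moreover have "(\<lambda>p. (pi * \<bar>\<kappa>\<bar>) ^ p / fact p * C) summable_on UNIV"
  proof -
    have "summable (\<lambda>p. (pi * \<bar>\<kappa>\<bar>) ^ p / fact p)"
      using summable_exp[of "pi * \<bar>\<kappa>\<bar>"] by (simp add: field_simps)
    then show ?thesis
      using summable_mult2[of "\<lambda>p. (pi * \<bar>\<kappa>\<bar>) ^ p / fact p" C] \<open>C \<ge> 0\<close>
      by (intro norm_summable_imp_summable_on) (simp add: abs_mult)
  qed
  ultimately have "((\<lambda>p. integral ?Q (u p)) has_sum integral ?Q (\<lambda>x. \<Sum>\<^sub>\<infinity>p. u p x)) UNIV"
    by (rule has_sum_integral_cbox(1))
  moreover have "(\<Sum>\<^sub>\<infinity>p. u p x) = cis (pi / a * fst x * \<kappa> * cos (snd x - \<Phi>)) * w x" for x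
  proof -
    have "summable (\<lambda>p. norm ((\<i> * of_real y) ^ p / fact p))" for y :: real
      using summable_norm_exp[of "\<i> * of_real y"] by (simp add: norm_divide norm_mult norm_power field_simps)
    moreover have "(\<lambda>p. (\<i> * of_real y) ^ p / fact p) sums cis y" for y :: real
      using exp_converges[of "\<i> * of_real y"]
      by (simp add: cis_conv_exp scaleR_conv_of_real field_simps)
    ultimately have "((\<lambda>p. (\<i> * of_real y) ^ p / fact p) has_sum cis y) UNIV" for y :: real
      by (intro norm_summable_imp_has_sum)
    then show ?thesis unfolding u_def by (intro infsumI has_sum_cmult_left)
  qed
  ultimately have "(\<lambda>p. integral ?Q (u p)) sums
      integral ?Q (\<lambda>x. cis (pi / a * fst x * \<kappa> * cos (snd x - \<Phi>)) * w x)"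
    by (simp add: has_sum_imp_sums)
  \<comment> \<open>Only the exponents \<open>n + 2 j\<close> contribute, so the series may be reindexed by \<open>j\<close>.\<close>
  moreover have "strict_mono (\<lambda>j. n + 2 * j)" by (auto simp: strict_mono_def)
  ultimately have "(\<lambda>j. integral ?Q (u (n + 2 * j))) sums
      integral ?Q (\<lambda>x. cis (pi / a * fst x * \<kappa> * cos (snd x - \<Phi>)) * w x)"
    using integral_zernike_cos_power(1)[OF assms, where \<kappa> = \<kappa> and \<Phi> = \<Phi>] unfolding u_eq[symmetric]
    by (subst sums_mono_reindex[of "\<lambda>j. n + 2 * j" "\<lambda>p. integral ?Q (u p)"]) auto
  moreover have "(\<lambda>j. integral ?Q (u (n + 2 * j))) sums
      (c * of_real ((pi * \<kappa> / 2) ^ n * (\<Sum>j. (- 1) ^ j / (fact j * fact (n + 1 + j)) * ((pi * \<kappa> / 2)\<^sup>2) ^ j)))"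
  proof -
    have eq: "integral ?Q (u (n + 2 * j)) = c * of_real ((pi * \<kappa> / 2) ^ n
                   * ((- 1) ^ j / (fact j * fact (n + 1 + j)) * ((pi * \<kappa> / 2)\<^sup>2) ^ j))" for j
      using integral_zernike_cos_power(2)[OF assms, of \<kappa> \<Phi> j] unfolding u_eq[symmetric] c_def .
    show ?thesis unfolding eq
      by (intro sums_mult sums_of_real summable_sums summable_bessel_series)
  qed
  ultimately have "integral ?Q (\<lambda>x. cis (pi / a * fst x * \<kappa> * cos (snd x - \<Phi>)) * w x)
      = c * of_real ((pi * \<kappa> / 2) ^ n * (\<Sum>j. (- 1) ^ j / (fact j * fact (n + 1 + j)) * ((pi * \<kappa> / 2)\<^sup>2) ^ j))"
    by (rule sums_unique2)
  then show ?thesis by (simp add: w_def c_def bessel_quotient_eq)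
qed

section \<open>Fourier series on the square\<close>

definition fourier_char :: "real \<Rightarrow> int \<times> int \<Rightarrow> real \<times> real \<Rightarrow> complex" where
  "fourier_char a k p = cis (pi / a * (of_int (fst k) * fst p + of_int (snd k) * snd p))"

lemma fourier_char_mult: "fourier_char a k p * fourier_char a l p = fourier_char a (k + l) p"
  by (simp add: fourier_char_def cis_mult ring_distribs add_ac)

lemma fourier_char_add: "fourier_char a k (p + q) = fourier_char a k p * fourier_char a k q"
  by (simp add: fourier_char_def cis_mult ring_distribs add_ac)

lemma cnj_fourier_char: "cnj (fourier_char a k p) = fourier_char a (- k) p"
  by (simp add: fourier_char_def cis_cnj ring_distribs)

lemma norm_fourier_char [simp]: "norm (fourier_char a k p) = 1"
  by (simp add: fourier_char_def)

lemma continuous_on_fourier_char [continuous_intros]: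
  "continuous_on S f \<Longrightarrow> continuous_on S (\<lambda>x. fourier_char a k (f x))"
  unfolding fourier_char_def by (intro continuous_intros)

lemma integral_fourier_char:
  assumes "a > 0"
  shows "integral (cbox (- a, - a) (a, a)) (fourier_char a k) = (if k = 0 then of_real (4 * a\<^sup>2) else 0)"
proof -
  have one: "integral {- a..a} (\<lambda>x. cis (2 * pi / (2 * a) * of_int q * x)) = (if q = 0 then of_real (2 * a) else 0)" for q
    using integral_cis_int[of "2 * a" "- a" q] assms by simp
  have "fourier_char a k p = cis (2 * pi / (2 * a) * of_int (fst k) * fst p) * cis (2 * pi / (2 * a) * of_int (snd k) * snd p)" for p
    by (simp add: fourier_char_def cis_mult ring_distribs mult_ac)
  then have "integral (cbox (- a, - a) (a, a)) (fourier_char a k)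
     = integral (cbox (- a, - a) (a, a)) (\<lambda>p. cis (2 * pi / (2 * a) * of_int (fst k) * fst p) * cis (2 * pi / (2 * a) * of_int (snd k) * snd p))"
    by presburger
  also have "\<dots> = (if fst k = 0 then of_real (2 * a) else 0) * (if snd k = 0 then of_real (2 * a) else 0)"
    unfolding one[symmetric] by (intro integral_cbox_product continuous_intros)
  finally show ?thesis by (auto simp: prod_eq_iff power2_eq_square)
qed

inductive trig_poly :: "real \<Rightarrow> (real \<times> real \<Rightarrow> complex) \<Rightarrow> bool" for a where
  fourier_char: "trig_poly a (fourier_char a k)"
| add: "trig_poly a f \<Longrightarrow> trig_poly a g \<Longrightarrow> trig_poly a (\<lambda>p. f p + g p)"
| scale: "trig_poly a f \<Longrightarrow> trig_poly a (\<lambda>p. c * f p)"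

lemma trig_poly_const: "trig_poly a (\<lambda>p. c)"
  using trig_poly.scale[OF trig_poly.fourier_char[of a 0], of c] by (simp add: fourier_char_def)

text \<open>
  Closure under products is what makes polynomials in the coordinates of the torus trigonometric
  polynomials.
\<close>

lemma trig_poly_mult:
  assumes "trig_poly a f" "trig_poly a g"
  shows "trig_poly a (\<lambda>p. f p * g p)"
  using assms
proof (induction f)
  case (fourier_char k)
  from this show ?case
  proof (induction g)
    case (fourier_char l)
    then show ?case by (simp add: fourier_char_mult trig_poly.fourier_char)
  next
    case (add f g)
    then show ?case by (simp add: distrib_left trig_poly.add)
  next
    case (scale f c)
    then show ?case by (simp add: mult.left_commute[of _ c] trig_poly.scale)
  qed
next
  case (add f g)
  then show ?case by (simp add: distrib_right trig_poly.add)
next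
  case (scale f c)
  then show ?case by (simp add: mult.assoc trig_poly.scale)
qed

lemma trig_poly_continuous: "trig_poly a f \<Longrightarrow> continuous_on S f"
  by (induction rule: trig_poly.induct) (auto intro!: continuous_intros)

text \<open>
  The identification of the opposite sides of the square \<open>[-a, a]\<^sup>2\<close>. The torus is embedded in a
  Euclidean space so that the Stone--Weierstrass theorem for polynomials applies to it.
\<close>

definition torus_map :: "real \<Rightarrow> real \<times> real \<Rightarrow> complex \<times> complex" where
  "torus_map a p = (cis (pi / a * fst p), cis (pi / a * snd p))"

text \<open>
  A linear form in the four real coordinates of the torus is a combination of the sines and cosines
  of \<open>\<pi> x / a\<close> and \<open>\<pi> y / a\<close>, that is, of four exponentials.
\<close>

lemma trig_poly_polynomial_torus_map:
  assumes "real_polynomial_function P"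
  shows "trig_poly a (\<lambda>p. of_real (P (torus_map a p)))"
  using assms
proof (induction P)
  case (linear f)
  then interpret bounded_linear f .
  have f: "f x = f (1, 0) * Re (fst x) + f (\<i>, 0) * Im (fst x) + f (0, 1) * Re (snd x) + f (0, \<i>) * Im (snd x)" for x
  proof -
    have "x = Re (fst x) *\<^sub>R (1, 0) + Im (fst x) *\<^sub>R (\<i>, 0) + Re (snd x) *\<^sub>R (0, 1) + Im (snd x) *\<^sub>R (0, \<i>)"
      by (simp add: prod_eq_iff complex_eq_iff)
    then have "f x = f (Re (fst x) *\<^sub>R (1, 0) + Im (fst x) *\<^sub>R (\<i>, 0) + Re (snd x) *\<^sub>R (0, 1) + Im (snd x) *\<^sub>R (0, \<i>))"
      by simp
    then show ?thesis unfolding add scaleR by simp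
  qed
  have cs: "complex_of_real (cos y) = (1/2) * cis y + (1/2) * cis (- y)"
    "complex_of_real (sin y) = (- \<i>/2) * cis y + (\<i>/2) * cis (- y)" for y
    by (simp_all add: complex_eq_iff)
  have eq: "complex_of_real (f (torus_map a p))
     = f (1, 0) * ((1/2) * fourier_char a (1, 0) p + (1/2) * fourier_char a (- 1, 0) p)
     + f (\<i>, 0) * ((- \<i>/2) * fourier_char a (1, 0) p + (\<i>/2) * fourier_char a (- 1, 0) p)
     + f (0, 1) * ((1/2) * fourier_char a (0, 1) p + (1/2) * fourier_char a (0, - 1) p)
     + f (0, \<i>) * ((- \<i>/2) * fourier_char a (0, 1) p + (\<i>/2) * fourier_char a (0, - 1) p)" for p
    unfolding f[of "torus_map a p"] by (simp add: torus_map_def fourier_char_def cs)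
  show ?case unfolding eq by (intro trig_poly.intros)
next
  case (const c)
  show ?case by (rule trig_poly_const)
next
  case (add f g)
  then show ?case by (simp add: trig_poly.add)
next
  case (mult f g)
  then show ?case by (simp add: trig_poly_mult)
qed

text \<open>
  A function on the square that is compatible with the identification of opposite sides descends to
  a function on the torus, which is continuous because the torus carries the quotient topology. There
  it is approximated by polynomials, and these pull back to trigonometric polynomials.
\<close>

lemma trig_poly_dense:
  assumes "a > 0" and cont: "continuous_on (cbox (- a, - a) (a, a)) d"
    and periodic: "\<And>p q. p \<in> cbox (- a, - a) (a, a) \<Longrightarrow> q \<in> cbox (- a, - a) (a, a) \<Longrightarrow>
                     torus_map a p = torus_map a q \<Longrightarrow> d p = d q"
    and "e > 0"
  obtains T where "trig_poly a T" "\<And>p. p \<in> cbox (- a, - a) (a, a) \<Longrightarrow> norm (d p - T p) < e"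
proof -
  let ?Q = "cbox (- a, - a) (a, a)"
  let ?T = "torus_map a ` ?Q"
  define D where "D z = d (SOME p. p \<in> ?Q \<and> torus_map a p = z)" for z
  have D: "D (torus_map a p) = d p" if "p \<in> ?Q" for p
  proof -
    have "(SOME q. q \<in> ?Q \<and> torus_map a q = torus_map a p) \<in> ?Q \<and>
          torus_map a (SOME q. q \<in> ?Q \<and> torus_map a q = torus_map a p) = torus_map a p"
      using that by (intro someI[of "\<lambda>q. q \<in> ?Q \<and> torus_map a q = torus_map a p" p]) simp
    then show ?thesis unfolding D_def using periodic that by blast
  qed
  have cont_torus: "continuous_on S (torus_map a)" for S
    unfolding torus_map_def by (intro continuous_intros)
  then have "compact ?T" by (intro compact_continuous_image) auto
  \<comment> \<open>A preimage of a closed set in the torus is the image of a compact set in the square,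
      hence closed.\<close>
  have "continuous_on ?T D"
  proof (subst continuous_on_closed_vimage)
    show "closed ?T" using \<open>compact ?T\<close> by (rule compact_imp_closed)
    show "\<forall>B. closed B \<longrightarrow> closed (D -` B \<inter> ?T)"
    proof (intro allI impI)
      fix B :: "complex set" assume "closed B"
      then have "closed (?Q \<inter> d -` B)"
        by (intro continuous_closed_preimage[OF cont]) auto
      then have "compact (?Q \<inter> (?Q \<inter> d -` B))" by (intro compact_Int_closed) auto
      then have "compact (torus_map a ` (?Q \<inter> (?Q \<inter> d -` B)))"
        using cont_torus by (intro compact_continuous_image)
      moreover have "torus_map a ` (?Q \<inter> (?Q \<inter> d -` B)) = D -` B \<inter> ?T"
        using D by force
      ultimately show "closed (D -` B \<inter> ?T)" by (metis compact_imp_closed)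
    qed
  qed
  then have "continuous_on ?T (\<lambda>z. Re (D z))" "continuous_on ?T (\<lambda>z. Im (D z))"
    by (intro continuous_intros; assumption)+
  moreover have "e / 2 > 0" using \<open>e > 0\<close> by simp
  ultimately obtain P1 P2 where P: "real_polynomial_function P1" "real_polynomial_function P2"
    and b1: "\<And>z. z \<in> ?T \<Longrightarrow> \<bar>Re (D z) - P1 z\<bar> < e / 2"
    and b2: "\<And>z. z \<in> ?T \<Longrightarrow> \<bar>Im (D z) - P2 z\<bar> < e / 2"
    using Stone_Weierstrass_real_polynomial_function[OF \<open>compact ?T\<close>] by metis
  let ?S = "\<lambda>p. complex_of_real (P1 (torus_map a p)) + \<i> * complex_of_real (P2 (torus_map a p))"
  show ?thesis
  proof
    show "trig_poly a ?S"
      using P by (intro trig_poly.add trig_poly.scale trig_poly_polynomial_torus_map)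
    fix p assume p: "p \<in> ?Q"
    have "norm (d p - ?S p) \<le> \<bar>Re (d p - ?S p)\<bar> + \<bar>Im (d p - ?S p)\<bar>" by (rule cmod_le)
    also have "\<dots> < e / 2 + e / 2"
      using b1[of "torus_map a p"] b2[of "torus_map a p"] p D[OF p] by simp
    finally show "norm (d p - ?S p) < e" by simp
  qed
qed

text \<open>
  If all coefficients vanish, then \<open>d\<close> is orthogonal to all trigonometric polynomials, hence to their
  uniform limit \<open>cnj d\<close>, so that the integral of \<open>\<bar>d\<bar>\<^sup>2\<close> is zero.
\<close>

lemma fourier_uniqueness:
  assumes "a > 0" and cont: "continuous_on (cbox (- a, - a) (a, a)) d"
    and periodic: "\<And>p q. p \<in> cbox (- a, - a) (a, a) \<Longrightarrow> q \<in> cbox (- a, - a) (a, a) \<Longrightarrow>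
                     torus_map a p = torus_map a q \<Longrightarrow> d p = d q"
    and coeff: "\<And>k. integral (cbox (- a, - a) (a, a)) (\<lambda>p. d p * fourier_char a k p) = 0"
    and "p \<in> cbox (- a, - a) (a, a)"
  shows "d p = 0"
proof -
  let ?Q = "cbox (- a, - a) (a, a)"
  have trig: "integral ?Q (\<lambda>p. d p * T p) = 0" if "trig_poly a T" for T
    using that
  proof (induction T)
    case (add f g)
    have "(\<lambda>p. d p * f p) integrable_on ?Q" "(\<lambda>p. d p * g p) integrable_on ?Q"
      by (intro integrable_continuous continuous_on_mult cont trig_poly_continuous[OF add(1)]
          trig_poly_continuous[OF add(2)])+
    then show ?case using add by (simp add: distrib_left integral_add)
  next
    case (scale f c)
    then show ?case by (simp add: mult.left_commute[of _ c])
  qed (rule coeff)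
  obtain C where C: "\<And>x. x \<in> ?Q \<Longrightarrow> norm (d x) \<le> C"
    using compact_imp_bounded[OF compact_continuous_image[OF cont compact_cbox]]
    by (auto simp: bounded_iff)
  have "0 \<in> ?Q" using \<open>a > 0\<close> by (simp add: cbox_Pair_eq zero_prod_def)
  from C[OF this] have "C \<ge> 0" by (meson norm_ge_zero order_trans)
  define J where "J = integral ?Q (\<lambda>p. d p * cnj (d p))"
  have "norm J \<le> 0"
  proof (rule field_le_epsilon)
    fix e :: real assume "e > 0"
    \<comment> \<open>Any positive \<open>K\<close> that bounds \<open>C\<close> times the area of the square does; the summands \<open>1\<close>
        only make it positive.\<close>
    define K where "K = (C + 1) * measure lborel ?Q + 1"
    have "K > 0" unfolding K_def using \<open>C \<ge> 0\<close> by (intro add_nonneg_pos mult_nonneg_nonneg) auto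
    then have "e / K > 0" using \<open>e > 0\<close> by simp
    moreover have "continuous_on ?Q (\<lambda>p. cnj (d p))" by (intro continuous_intros cont)
    moreover have "cnj (d p) = cnj (d q)" if "p \<in> ?Q" "q \<in> ?Q" "torus_map a p = torus_map a q" for p q
      using periodic[OF that] by simp
    ultimately obtain T where T: "trig_poly a T" and approx: "\<And>p. p \<in> ?Q \<Longrightarrow> norm (cnj (d p) - T p) < e / K"
      using trig_poly_dense[OF \<open>a > 0\<close>] by blast
    have int: "(\<lambda>p. d p * cnj (d p)) integrable_on ?Q" "(\<lambda>p. d p * T p) integrable_on ?Q"
      by (intro integrable_continuous continuous_on_mult continuous_on_cnj cont trig_poly_continuous[OF T])+
    have "J = integral ?Q (\<lambda>p. d p * (cnj (d p) - T p))"
      using trig[OF T] integral_diff[OF int] by (simp add: J_def right_diff_distrib)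
    also have "norm \<dots> \<le> (C * (e / K)) * measure lborel ?Q"
    proof (rule integrable_bound)
      show "0 \<le> C * (e / K)" using \<open>C \<ge> 0\<close> \<open>e / K > 0\<close> by (intro mult_nonneg_nonneg) auto
      show "(\<lambda>p. d p * (cnj (d p) - T p)) integrable_on ?Q"
        using integrable_diff[OF int] by (simp add: right_diff_distrib)
      show "norm (d p * (cnj (d p) - T p)) \<le> C * (e / K)" if "p \<in> ?Q" for p
        unfolding norm_mult using C[OF that] approx[OF that] \<open>C \<ge> 0\<close> by (intro mult_mono) auto
    qed
    also have "\<dots> = (C * measure lborel ?Q / K) * e" by simp
    also have "\<dots> \<le> 1 * e"
    proof (rule mult_right_mono)
      have "C * measure lborel ?Q \<le> K" unfolding K_def by (simp add: distrib_right)
      then show "C * measure lborel ?Q / K \<le> 1" using \<open>K > 0\<close> by simp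
    qed (use \<open>e > 0\<close> in simp)
    finally show "norm J \<le> 0 + e" by simp
  qed
  then have "J = 0" by simp
  have "((\<lambda>p. d p * cnj (d p)) has_integral 0) ?Q"
    unfolding \<open>J = 0\<close>[symmetric] J_def
    by (intro integrable_integral integrable_continuous continuous_intros cont)
  from has_integral_linear[OF this bounded_linear_Re]
  have int0: "((\<lambda>p. (norm (d p))\<^sup>2) has_integral 0) ?Q"
    by (simp add: o_def complex_mult_cnj cmod_power2)
  have "(norm (d p))\<^sup>2 = 0"
    using int0
  proof (rule has_integral_0_cbox_imp_0[rotated 2])
    show "continuous_on ?Q (\<lambda>p. (norm (d p))\<^sup>2)" by (intro continuous_intros cont)
    show "box (- a, - a) (a, a) \<noteq> {}" using \<open>a > 0\<close> by (auto simp: box_ne_empty Basis_prod_def)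
  qed (use \<open>a > 0\<close> \<open>p \<in> ?Q\<close> in simp_all)
  then show ?thesis by simp
qed

text \<open>
  The series converges uniformly to a continuous periodic function. By termwise integration this
  function has the same coefficients as \<open>h\<close>, and so it is \<open>h\<close>.
\<close>

lemma fourier_series_of_summable_coeffs:
  assumes "a > 0" and cont: "continuous_on (cbox (- a, - a) (a, a)) h"
    and periodic: "\<And>p q. p \<in> cbox (- a, - a) (a, a) \<Longrightarrow> q \<in> cbox (- a, - a) (a, a) \<Longrightarrow>
                     torus_map a p = torus_map a q \<Longrightarrow> h p = h q"
    and coeff: "\<And>k. integral (cbox (- a, - a) (a, a)) (\<lambda>p. h p * fourier_char a (- k) p) = of_real (4 * a\<^sup>2) * c k"
    and summable: "(\<lambda>k. norm (c k)) summable_on UNIV"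
    and "p \<in> cbox (- a, - a) (a, a)"
  shows "h p = (\<Sum>\<^sub>\<infinity>k. c k * fourier_char a k p)"
proof -
  let ?Q = "cbox (- a, - a) (a, a)"
  define g where "g p = (\<Sum>\<^sub>\<infinity>k. c k * fourier_char a k p)" for p
  have cont_g: "continuous_on ?Q g"
    unfolding g_def
    by (rule has_sum_integral_cbox(2)[OF _ _ summable]) (auto intro!: continuous_intros simp: norm_mult)
  have g_coeff: "integral ?Q (\<lambda>p. g p * fourier_char a (- l) p) = of_real (4 * a\<^sup>2) * c l" for l
  proof -
    have eq: "g p * fourier_char a (- l) p = (\<Sum>\<^sub>\<infinity>k. c k * fourier_char a (k - l) p)" for p
      unfolding g_def by (subst infsum_cmult_left'[symmetric]) (simp add: mult.assoc fourier_char_mult)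
    have "((\<lambda>k. integral ?Q (\<lambda>p. c k * fourier_char a (k - l) p)) has_sum
             integral ?Q (\<lambda>p. \<Sum>\<^sub>\<infinity>k. c k * fourier_char a (k - l) p)) UNIV"
      by (rule has_sum_integral_cbox(1)[OF _ _ summable]) (auto intro!: continuous_intros simp: norm_mult)
    moreover have "integral ?Q (\<lambda>p. c k * fourier_char a (k - l) p) = (if k = l then of_real (4 * a\<^sup>2) * c l else 0)" for k
      using integral_fourier_char[OF \<open>a > 0\<close>, of "k - l"] by simp
    ultimately have "((\<lambda>k. if k = l then of_real (4 * a\<^sup>2) * c l else 0) has_sum
        integral ?Q (\<lambda>p. g p * fourier_char a (- l) p)) UNIV"
      by (simp only: eq)
    moreover have "((\<lambda>k. if k = l then of_real (4 * a\<^sup>2) * c l else 0) has_sum of_real (4 * a\<^sup>2) * c l) UNIV"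
      using has_sum_finite_neutralI[of "{l}" UNIV "\<lambda>k. if k = l then of_real (4 * a\<^sup>2) * c l else 0"] by simp
    ultimately show ?thesis using has_sum_unique by blast
  qed
  have "h p - g p = 0"
  proof (rule fourier_uniqueness[of a "\<lambda>p. h p - g p"])
    show "continuous_on ?Q (\<lambda>p. h p - g p)" by (intro continuous_intros cont cont_g)
    \<comment> \<open>The exponentials are monomials in the coordinates of the torus, so \<open>g\<close> is periodic.\<close>
    show "h p - g p = h q - g q" if "p \<in> ?Q" "q \<in> ?Q" and eq: "torus_map a p = torus_map a q" for p q
    proof -
      have "fourier_char a k x = fst (torus_map a x) powi fst k * snd (torus_map a x) powi snd k" for k x
        by (simp add: fourier_char_def torus_map_def cis_power_int cis_mult ring_distribs mult_ac)
      then have "g p = g q" using eq by (simp add: g_def)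
      then show ?thesis using periodic[OF that] by simp
    qed
    show "integral ?Q (\<lambda>p. (h p - g p) * fourier_char a k p) = 0" for k
    proof -
      have "(\<lambda>p. h p * fourier_char a (- (- k)) p) integrable_on ?Q" "(\<lambda>p. g p * fourier_char a (- (- k)) p) integrable_on ?Q"
        by (auto intro!: integrable_continuous continuous_intros cont cont_g)
      from integral_diff[OF this] show ?thesis
        using coeff[of "- k"] g_coeff[of "- k"] by (simp add: left_diff_distrib)
    qed
  qed (use \<open>a > 0\<close> \<open>p \<in> ?Q\<close> in simp_all)
  then show ?thesis by (simp add: g_def)
qed

section \<open>The plane as pairs of reals, and polar coordinates\<close>

text \<open>
  Product types have Fubini's theorem for boxes, while the change of variables theorem is about vectors
  \<open>real ^ 2\<close>. This isometry moves integrals from one model of the plane to the other.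
\<close>

definition vec2 :: "real \<times> real \<Rightarrow> real ^ 2" where
  "vec2 p = vector [fst p, snd p]"

lemma vec2_nth [simp]: "vec2 p $ 1 = fst p" "vec2 p $ 2 = snd p"
  by (simp_all add: vec2_def)

lemma vec2_eta [simp]: "vec2 (v $ 1, v $ 2) = v"
  by (simp add: vec_eq_iff forall_2)

lemma linear_vec2: "linear vec2"
  by (rule linearI) (simp_all add: vec_eq_iff forall_2)

lemma vec2_diff: "vec2 (p - q) = vec2 p - vec2 q"
  by (simp add: vec_eq_iff forall_2)

lemma norm_vec2 [simp]: "norm (vec2 p) = norm p"
  by (cases p) (simp add: norm_vec_def L2_set_def sum_2 norm_Pair)

lemma continuous_on_vec2 [continuous_intros]:
  "continuous_on S f \<Longrightarrow> continuous_on S (\<lambda>x. vec2 (f x))"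
  using linear_vec2
  by (intro continuous_on_compose2[OF linear_continuous_on[of vec2 UNIV]]) (auto simp: linear_conv_bounded_linear)

lemma measurable_vec2 [measurable]: "vec2 \<in> borel_measurable borel"
  using continuous_on_vec2[OF continuous_on_id] by (intro borel_measurable_continuous_onI) simp

lemma Basis_real2: "Basis = {axis 1 1, axis 2 1 :: real ^ 2}"
  by (auto simp: Basis_vec_def UNIV_2)

lemma axis_real2_neq: "axis 1 1 \<noteq> (axis 2 1 :: real ^ 2)"
  by (simp add: axis_eq_axis)

lemma vimage_vec2_cbox: "vec2 -` cbox (vec2 l) (vec2 u) = cbox l u"
  by (cases l; cases u) (auto simp: cbox_Pair_eq mem_box_cart forall_2)

lemma distr_lborel_vec2: "distr lborel borel vec2 = lborel"
proof (rule lborel_eqI[symmetric])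
  fix l u :: "real ^ 2"
  assume le: "\<And>b. b \<in> Basis \<Longrightarrow> l \<bullet> b \<le> u \<bullet> b"
  have le': "l $ 1 \<le> u $ 1" "l $ 2 \<le> u $ 2"
    using le[of "axis 1 1"] le[of "axis 2 1"] by (simp_all add: Basis_real2 inner_axis)
  have "vec2 -` box l u = box (l $ 1, l $ 2) (u $ 1, u $ 2)"
    by (auto simp: mem_box_cart forall_2 mem_box Basis_prod_def)
  then have "emeasure (distr lborel borel vec2) (box l u) = emeasure lborel (box (l $ 1, l $ 2) (u $ 1, u $ 2))"
    by (simp add: emeasure_distr)
  also have "\<dots> = (\<Prod>b\<in>Basis. ((u $ 1, u $ 2) - (l $ 1, l $ 2)) \<bullet> b)"
    using le' by (intro emeasure_lborel_box) (auto simp: Basis_prod_def)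
  also have "(\<Prod>b\<in>Basis. ((u $ 1, u $ 2) - (l $ 1, l $ 2)) \<bullet> b) = (u $ 1 - l $ 1) * (u $ 2 - l $ 2)"
    by (simp add: Basis_prod_def)
  also have "\<dots> = (\<Prod>b\<in>Basis. (u - l) \<bullet> b)"
    unfolding Basis_real2 using axis_real2_neq by (simp add: inner_axis)
  finally show "emeasure (distr lborel borel vec2) (box l u) = (\<Prod>b\<in>Basis. (u - l) \<bullet> b)" .
qed simp

lemma integral_lborel_vec2:
  fixes f :: "real ^ 2 \<Rightarrow> 'b :: {banach, second_countable_topology}"
  assumes [measurable]: "f \<in> borel_measurable borel"
  shows "(LINT v|lborel. f v) = (LINT p|lborel. f (vec2 p))"
  by (subst distr_lborel_vec2[symmetric], subst integral_distr) auto

lemma set_integrable_compact_continuous: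
  fixes f :: "'a :: euclidean_space \<Rightarrow> 'b :: euclidean_space"
  assumes "compact S" "continuous_on S f"
  shows "set_integrable lborel S f" "(LINT x:S|lborel. f x) = integral S f"
proof -
  show 1: "set_integrable lborel S f"
    using borel_integrable_compact[OF assms] by (simp add: set_integrable_def)
  show "(LINT x:S|lborel. f x) = integral S f"
    by (rule set_borel_integral_eq_integral(2)[OF 1])
qed

text \<open>
  The polar integrals of the statement are iterated Lebesgue integrals; for continuous integrands they
  are integrals over a box, where uniform limits and changes of variables are available.
\<close>

lemma iterated_set_integral_eq_integral_cbox:
  fixes G :: "real \<times> real \<Rightarrow> complex"
  assumes cont: "continuous_on (cbox (0, 0) (A, B)) G"
  shows "(LBINT r:{0..A}. (LBINT \<theta>:{0..B}. G (r, \<theta>))) = integral (cbox (0, 0) (A, B)) G"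
proof -
  have prod: "cbox (0, 0) (A, B) = {0..A} \<times> {0..B}" by (simp add: cbox_Pair_eq)
  have inner: "(LBINT \<theta>:{0..B}. G (r, \<theta>)) = integral {0..B} (\<lambda>\<theta>. G (r, \<theta>))" if "r \<in> {0..A}" for r
    using that by (intro set_integrable_compact_continuous continuous_on_compose2[OF cont] continuous_intros)
      (auto simp: prod)
  have "continuous_on {0..A} (\<lambda>r. integral (cbox 0 B) (\<lambda>\<theta>. G (r, \<theta>)))"
    using cont by (intro integral_continuous_on_param) (simp add: prod case_prod_eta)
  then have "(LBINT r:{0..A}. integral {0..B} (\<lambda>\<theta>. G (r, \<theta>))) = integral {0..A} (\<lambda>r. integral {0..B} (\<lambda>\<theta>. G (r, \<theta>)))"
    by (intro set_integrable_compact_continuous(2)) auto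
  moreover have "(LBINT r:{0..A}. (LBINT \<theta>:{0..B}. G (r, \<theta>))) = (LBINT r:{0..A}. integral {0..B} (\<lambda>\<theta>. G (r, \<theta>)))"
    using inner by (intro set_lebesgue_integral_cong) auto
  ultimately show ?thesis
    using integral_prod_continuous[OF cont] by simp
qed

definition polar_map :: "real ^ 2 \<Rightarrow> real ^ 2" where
  "polar_map v = polar (v $ 1) (v $ 2)"

lemma polar_map_nth [simp]:
  "polar_map v $ 1 = v $ 1 * cos (v $ 2)" "polar_map v $ 2 = v $ 1 * sin (v $ 2)"
  by (simp_all add: polar_map_def polar_def)

lemma norm_polar [simp]: "norm (polar r \<theta>) = \<bar>r\<bar>"
proof -
  have "(r * cos \<theta>)\<^sup>2 + (r * sin \<theta>)\<^sup>2 = r\<^sup>2 * ((cos \<theta>)\<^sup>2 + (sin \<theta>)\<^sup>2)"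
    by (simp only: power_mult_distrib distrib_left)
  then show ?thesis by (simp add: norm_vec_def L2_set_def sum_2 polar_def)
qed

lemma continuous_on_polar [continuous_intros]:
  fixes f g :: "'a :: t2_space \<Rightarrow> real"
  assumes "continuous_on S f" "continuous_on S g"
  shows "continuous_on S (\<lambda>x. polar (f x) (g x))"
proof -
  from assms have "continuous_on S (\<lambda>x. vec2 (f x * cos (g x), f x * sin (g x)))"
    by (intro continuous_intros)
  then show ?thesis by (simp add: polar_def vec2_def)
qed

lemma has_derivative_polar_map:
  "(polar_map has_derivative
     (\<lambda>h. vec2 (h $ 1 * cos (v $ 2) - v $ 1 * sin (v $ 2) * h $ 2,
                h $ 1 * sin (v $ 2) + v $ 1 * cos (v $ 2) * h $ 2))) (at v within S)"
proof -
  note [derivative_intros] = bounded_linear.has_derivative[OF bounded_linear_vec_nth]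
  have eq: "polar_map v = vec2 (v $ 1 * cos (v $ 2), v $ 1 * sin (v $ 2))" for v
    by (simp add: vec_eq_iff forall_2)
  have "((\<lambda>v. (v $ 1 * cos (v $ 2), v $ 1 * sin (v $ 2))) has_derivative
     (\<lambda>h. (h $ 1 * cos (v $ 2) - v $ 1 * sin (v $ 2) * h $ 2,
                h $ 1 * sin (v $ 2) + v $ 1 * cos (v $ 2) * h $ 2))) (at v within S)"
    by (rule derivative_eq_intros refl | simp add: fun_eq_iff algebra_simps)+
  from bounded_linear.has_derivative[OF linear_vec2[THEN linear_conv_bounded_linear[THEN iffD1]] this]
  show ?thesis unfolding eq .
qed

lemma det_derivative_polar_map:
  "det (matrix (\<lambda>h. vec2 (h $ 1 * cos (v $ 2) - v $ 1 * sin (v $ 2) * h $ 2,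
                h $ 1 * sin (v $ 2) + v $ 1 * cos (v $ 2) * h $ 2))) = v $ 1"
proof -
  have "v $ 1 * (cos (v $ 2))\<^sup>2 + v $ 1 * (sin (v $ 2))\<^sup>2 = v $ 1"
    by (simp flip: distrib_left)
  then show ?thesis
    by (simp add: det_2 matrix_def axis_def power2_eq_square algebra_simps)
qed

lemma inj_on_polar_map: "inj_on polar_map (box (vec2 (0, 0)) (vec2 (b, 2 * pi)))"
proof (rule inj_onI)
  fix v w assume v: "v \<in> box (vec2 (0, 0)) (vec2 (b, 2 * pi))" and w: "w \<in> box (vec2 (0, 0)) (vec2 (b, 2 * pi))"
    and eq: "polar_map v = polar_map w"
  have "\<bar>v $ 1\<bar> = \<bar>w $ 1\<bar>" using arg_cong[OF eq, of norm] by (simp add: polar_map_def)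
  then have 1: "v $ 1 = w $ 1" and "w $ 1 > 0" using v w by (auto simp: mem_box_cart forall_2)
  then have "cos (v $ 2) = cos (w $ 2)" "sin (v $ 2) = sin (w $ 2)"
    using arg_cong[OF eq, of "\<lambda>x. x $ 1"] arg_cong[OF eq, of "\<lambda>x. x $ 2"] by auto
  then obtain n :: int where n: "v $ 2 = w $ 2 + 2 * pi * n"
    using sin_cos_eq_iff[of "v $ 2" "w $ 2"] by auto
  moreover have "\<bar>v $ 2 - w $ 2\<bar> < 2 * pi" using v w by (auto simp: mem_box_cart forall_2)
  moreover have pi_2_gt_0: "0 < 2 * pi" by simp
  ultimately have "2 * pi * \<bar>real_of_int n\<bar> < 2 * pi * 1" by (simp add: abs_mult)
  then have "n = 0" unfolding mult_less_cancel_left_pos[OF pi_2_gt_0] by linarith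
  with n have "v $ 2 = w $ 2" by simp
  with 1 show "v = w" by (simp add: vec_eq_iff forall_2)
qed

text \<open>
  On the open box the polar map misses only null sets of the disc: the origin and the positive real
  axis, both contained in the line \<open>v $ 2 = 0\<close>, and the bounding circle.
\<close>

lemma polar_map_image:
  "polar_map ` box (vec2 (0, 0)) (vec2 (b, 2 * pi)) \<subseteq> cball 0 b"
  "cball 0 b - polar_map ` box (vec2 (0, 0)) (vec2 (b, 2 * pi)) \<subseteq> sphere 0 b \<union> {v. v $ 2 = 0}"
proof -
  show "polar_map ` box (vec2 (0, 0)) (vec2 (b, 2 * pi)) \<subseteq> cball 0 b"
    by (auto simp: polar_map_def mem_box_cart forall_2)
  have "v \<in> polar_map ` box (vec2 (0, 0)) (vec2 (b, 2 * pi))"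
    if v: "norm v < b" "v $ 2 \<noteq> 0" for v :: "real ^ 2"
  proof -
    define z where "z = Complex (v $ 1) (v $ 2)"
    have z: "cmod z = norm v" by (simp add: z_def norm_vec_def L2_set_def sum_2 cmod_def)
    have "v = polar_map (vec2 (cmod z, Arg2pi z))"
      using cos_Arg2pi[of z] sin_Arg2pi[of z] by (simp add: vec_eq_iff forall_2 z_def)
    moreover have "Arg2pi z \<noteq> 0" using sin_Arg2pi[of z] v by (auto simp: z_def)
    then have "vec2 (cmod z, Arg2pi z) \<in> box (vec2 (0, 0)) (vec2 (b, 2 * pi))"
      using v z Arg2pi_ge_0[of z] Arg2pi_lt_2pi[of z] by (auto simp: mem_box_cart forall_2 less_le)
    ultimately show ?thesis by blast
  qed
  then show "cball 0 b - polar_map ` box (vec2 (0, 0)) (vec2 (b, 2 * pi)) \<subseteq> sphere 0 b \<union> {v. v $ 2 = 0}"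
    by (fastforce simp: less_le)
qed

lemma integral_cball_polar:
  fixes F :: "real ^ 2 \<Rightarrow> complex"
  assumes F: "continuous_on UNIV F"
  shows "integral (cball 0 b) F
       = integral (cbox (vec2 (0, 0)) (vec2 (b, 2 * pi))) (\<lambda>v. F (polar_map v) * of_real (v $ 1))"
proof -
  let ?S = "box (vec2 (0, 0)) (vec2 (b, 2 * pi))"
  \<comment> \<open>The change of variables theorem is about vector-valued functions, so complex values are
      read as pairs of reals and translated back by \<open>c\<close>.\<close>
  define f where "f v = vec2 (Re (F v), Im (F v))" for v
  define c where "c w = Complex (w $ 1) (w $ 2)" for w :: "real ^ 2"
  have "linear c" by (rule linearI) (simp_all add: c_def complex_eq_iff)
  then have c: "bounded_linear c" by (simp add: linear_conv_bounded_linear)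
  have cf: "c (f v) = F v" for v by (simp add: c_def f_def complex_eq_iff)
  have cont_f: "continuous_on T f" for T
    unfolding f_def by (intro continuous_intros continuous_on_subset[OF F]) auto
  have neg: "negligible {v \<in> cball 0 b - polar_map ` ?S. f v \<noteq> 0}"
  proof (rule negligible_subset)
    have "{v :: real ^ 2. v $ 2 = 0} = {v. v \<bullet> axis 2 1 = 0}" by (simp add: inner_axis)
    moreover have "negligible {v :: real ^ 2. v \<bullet> axis 2 1 = 0}"
      by (rule negligible_standard_hyperplane) (simp add: Basis_real2)
    ultimately show "negligible (sphere 0 b \<union> {v :: real ^ 2. v $ 2 = 0})"
      by (simp add: negligible_sphere)
  qed (use polar_map_image(2) in blast)
  have empty: "{v \<in> polar_map ` ?S - cball 0 b. f v \<noteq> 0} = {}"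
    using polar_map_image(1)[of b] by blast
  have "set_integrable lborel (cball 0 b) f"
    by (intro set_integrable_compact_continuous cont_f) auto
  then have "f absolutely_integrable_on cball 0 b"
    unfolding set_integrable_def by (subst integrable_completion) (auto dest: borel_measurable_integrable)
  then have "f absolutely_integrable_on polar_map ` ?S"
    by (rule absolutely_integrable_spike_set) (simp_all only: neg empty negligible_empty)
  moreover have "integral (polar_map ` ?S) f = integral (cball 0 b) f"
    by (rule integral_spike_set) (simp_all only: neg empty negligible_empty)
  ultimately have *: "(\<lambda>v. \<bar>v $ 1\<bar> *\<^sub>R f (polar_map v)) absolutely_integrable_on ?S"
    "integral ?S (\<lambda>v. \<bar>v $ 1\<bar> *\<^sub>R f (polar_map v)) = integral (cball 0 b) f"
    using has_absolute_integral_change_of_variables[OF _ has_derivative_polar_map inj_on_polar_map,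
        of b f "integral (cball 0 b) f"]
    unfolding det_derivative_polar_map by auto
  have "integral (cball 0 b) F = c (integral (cball 0 b) f)"
    using integral_linear[OF set_borel_integral_eq_integral(1) c, of "cball 0 b" f]
      \<open>set_integrable lborel (cball 0 b) f\<close> by (simp add: o_def cf)
  also have "\<dots> = integral ?S (\<lambda>v. c (\<bar>v $ 1\<bar> *\<^sub>R f (polar_map v)))"
    using integral_linear[OF set_lebesgue_integral_eq_integral(1)[OF *(1)] c] by (simp add: o_def *(2))
  also have "\<dots> = integral ?S (\<lambda>v. F (polar_map v) * of_real (v $ 1))"
  proof (rule integral_cong)
    fix v assume "v \<in> ?S"
    then have "v $ 1 > 0" by (simp add: mem_box_cart forall_2)
    moreover have "c (\<bar>v $ 1\<bar> *\<^sub>R f (polar_map v)) = \<bar>v $ 1\<bar> *\<^sub>R F (polar_map v)"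
      by (simp only: linear_cmul[OF \<open>linear c\<close>] cf)
    ultimately show "c (\<bar>v $ 1\<bar> *\<^sub>R f (polar_map v)) = F (polar_map v) * of_real (v $ 1)"
      by (simp add: scaleR_conv_of_real)
  qed
  finally show ?thesis by (simp add: integral_open_interval)
qed

lemma integral_compact_vec2:
  fixes f :: "real ^ 2 \<Rightarrow> complex"
  assumes "compact S" and f: "continuous_on UNIV f"
  shows "integral S f = (LINT p|lborel. indicator S (vec2 p) *\<^sub>R f (vec2 p))"
proof -
  have [measurable]: "f \<in> borel_measurable borel" using f by (rule borel_measurable_continuous_onI)
  have [measurable]: "S \<in> sets borel" using \<open>compact S\<close> by (simp add: borel_compact)
  have "integral S f = (LINT x:S|lborel. f x)"
    using assms by (intro set_integrable_compact_continuous(2)[symmetric]) (auto intro: continuous_on_subset)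
  then show ?thesis unfolding set_lebesgue_integral_def by (subst (asm) integral_lborel_vec2) auto
qed

lemma integral_polar_coordinates:
  fixes F :: "real ^ 2 \<Rightarrow> complex"
  assumes F: "continuous_on UNIV F"
  shows "integral (cbox (0, 0) (b, 2 * pi)) (\<lambda>x. F (polar (fst x) (snd x)) * of_real (fst x))
       = (LINT p|lborel. indicator (cball 0 b) p *\<^sub>R F (vec2 p))"
proof -
  define G where "G v = F (polar_map v) * of_real (v $ 1)" for v
  have G: "continuous_on UNIV G"
    unfolding G_def polar_map_def by (intro continuous_intros continuous_on_compose2[OF F]) auto
  have "(LINT p|lborel. indicator (cball 0 b) p *\<^sub>R F (vec2 p)) = integral (cball 0 b) F"
    unfolding integral_compact_vec2[OF compact_cball F] by (simp add: indicator_def)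
  also have "\<dots> = integral (cbox (vec2 (0, 0)) (vec2 (b, 2 * pi))) G"
    unfolding G_def by (rule integral_cball_polar[OF F])
  also have "\<dots> = (LINT p|lborel. indicator (cbox (0, 0) (b, 2 * pi)) p *\<^sub>R G (vec2 p))"
    unfolding integral_compact_vec2[OF compact_cbox G] vimage_vec2_cbox[symmetric]
    by (simp add: indicator_vimage)
  also have "\<dots> = integral (cbox (0, 0) (b, 2 * pi)) (\<lambda>p. G (vec2 p))"
    unfolding set_lebesgue_integral_def[symmetric]
    by (intro set_integrable_compact_continuous(2) continuous_on_compose2[OF G] continuous_intros) auto
  finally show ?thesis by (simp add: G_def polar_map_def)
qed

section \<open>Convolutions\<close>

lemma integral_lborel_translate:
  fixes f :: "'a :: euclidean_space \<Rightarrow> 'b :: {banach, second_countable_topology}"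
  assumes [measurable]: "f \<in> borel_measurable borel"
  shows "(LINT x|lborel. f (c + x)) = (LINT x|lborel. f x)"
    and "integrable lborel (\<lambda>x. f (c + x)) \<longleftrightarrow> integrable lborel f"
proof -
  have "(LINT x|lborel. f x) = (LINT x|distr lborel borel ((+) c). f x)"
    by (simp only: lborel_distr_plus)
  also have "\<dots> = (LINT x|lborel. f (c + x))" by (rule integral_distr) auto
  finally show "(LINT x|lborel. f (c + x)) = (LINT x|lborel. f x)" ..
  have "integrable lborel f \<longleftrightarrow> integrable (distr lborel borel ((+) c)) f"
    by (simp only: lborel_distr_plus)
  also have "\<dots> \<longleftrightarrow> integrable lborel (\<lambda>x. f (c + x))" by (rule integrable_distr_eq) auto
  finally show "integrable lborel (\<lambda>x. f (c + x)) \<longleftrightarrow> integrable lborel f" ..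
qed

text \<open>
  The convolution theorem: substitute \<open>x + y\<close> for \<open>x\<close> in the inner integral, after Fubini, and use that
  \<open>\<phi>\<close> is multiplicative.
\<close>

lemma convolution_times_character:
  fixes u v \<phi> :: "'a :: euclidean_space \<Rightarrow> complex"
  assumes u: "integrable lborel u" and v: "integrable lborel v"
    and [measurable]: "\<phi> \<in> borel_measurable borel"
    and norm: "\<And>x. norm (\<phi> x) = 1" and hom: "\<And>x y. \<phi> (x + y) = \<phi> x * \<phi> y"
  shows "(LINT x|lborel. (LINT y|lborel. u y * v (x - y)) * \<phi> x)
         = (LINT x|lborel. u x * \<phi> x) * (LINT x|lborel. v x * \<phi> x)"
proof -
  have [measurable]: "u \<in> borel_measurable borel" "v \<in> borel_measurable borel"
    using borel_measurable_integrable[OF u] borel_measurable_integrable[OF v] by simp_all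
  have shift: "(LINT x|lborel. g (x - y)) = (LINT x|lborel. g x)"
    "integrable lborel (\<lambda>x. g (x - y)) \<longleftrightarrow> integrable lborel g"
    if "g \<in> borel_measurable borel" for g :: "'a \<Rightarrow> 'c :: {banach, second_countable_topology}" and y
    using integral_lborel_translate[OF that, of "- y"] by (simp_all add: algebra_simps)
  define f where "f = (\<lambda>(y, x). u y * v (x - y) * \<phi> x)"
  have f: "integrable (lborel \<Otimes>\<^sub>M lborel) f"
  proof (rule lborel_pair.Fubini_integrable)
    show "f \<in> borel_measurable (lborel \<Otimes>\<^sub>M lborel)" unfolding f_def by measurable
    have "(LINT x|lborel. norm (f (y, x))) = norm (u y) * (LINT x|lborel. norm (v x))" for y
      using shift(1)[of "\<lambda>x. norm (v x)" y] by (simp add: f_def norm_mult norm)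
    then show "integrable lborel (\<lambda>y. LINT x|lborel. norm (f (y, x)))" using u by simp
    have "integrable lborel (\<lambda>x. f (y, x))" for y
    proof (rule Bochner_Integration.integrable_bound)
      show "integrable lborel (\<lambda>x. norm (u y) * norm (v (x - y)))"
        using v shift(2)[of "\<lambda>x. norm (v x)" y] by (intro integrable_mult_right) simp
      show "(\<lambda>x. f (y, x)) \<in> borel_measurable lborel" unfolding f_def prod.case by measurable
    qed (simp add: f_def norm_mult norm)
    then show "AE y in lborel. integrable lborel (\<lambda>x. f (y, x))" by simp
  qed
  have "(LINT x|lborel. (LINT y|lborel. u y * v (x - y)) * \<phi> x) = (LINT x|lborel. (LINT y|lborel. f (y, x)))"
    by (simp add: f_def)
  also have "\<dots> = (LINT y|lborel. (LINT x|lborel. f (y, x)))"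
    using lborel_pair.Fubini_integral[of "\<lambda>y x. f (y, x)"] f by simp
  also have "\<dots> = (LINT y|lborel. (u y * \<phi> y) * (LINT x|lborel. v x * \<phi> x))"
  proof (rule Bochner_Integration.integral_cong[OF refl])
    fix y
    have "f (y, x) = (u y * \<phi> y) * (v (x - y) * \<phi> (x - y))" for x
      using hom[of y "x - y"] by (simp add: f_def)
    then have "(LINT x|lborel. f (y, x)) = (u y * \<phi> y) * (LINT x|lborel. v (x - y) * \<phi> (x - y))"
      by simp
    also have "(LINT x|lborel. v (x - y) * \<phi> (x - y)) = (LINT x|lborel. v x * \<phi> x)"
      by (rule shift(1)) measurable
    finally show "(LINT x|lborel. f (y, x)) = (u y * \<phi> y) * (LINT x|lborel. v x * \<phi> x)" .
  qed
  finally show ?thesis by simp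
qed

text \<open>
  Dominated convergence: for fixed \<open>x\<close>, the integrand is continuous in \<open>x\<close> for all \<open>y\<close> outside the null
  set \<open>x - N\<close>. So a convolution is continuous even if \<open>v\<close> jumps, as a truncated function does on the
  circle that bounds its window.
\<close>

lemma continuous_on_convolution:
  fixes u v :: "'a :: euclidean_space \<Rightarrow> complex"
  assumes u: "integrable lborel u"
    and [measurable]: "v \<in> borel_measurable borel" and bound: "\<And>x. norm (v x) \<le> C"
    and N: "closed N" "negligible N" and cont: "\<And>x. x \<notin> N \<Longrightarrow> isCont v x"
  shows "continuous_on UNIV (\<lambda>x. LINT y|lborel. u y * v (x - y))"
  unfolding continuous_on_sequentially
proof (intro allI ballI impI, elim conjE)
  fix X :: "nat \<Rightarrow> 'a" and x
  assume X: "X \<longlonglongrightarrow> x"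
  have [measurable]: "u \<in> borel_measurable borel"
    using borel_measurable_integrable[OF u] by simp
  have "{y. x - y \<in> N} = (\<lambda>z. x - z) ` N" by force
  moreover have "negligible ((\<lambda>z. x - z) ` N)"
    by (rule negligible_locally_Lipschitz_image[OF order_refl N(2)])
       (auto intro!: exI[of _ UNIV] exI[of _ 1] simp: norm_minus_commute)
  ultimately have "{y. x - y \<in> N} \<in> null_sets lebesgue" by (simp add: negligible_iff_null_sets)
  moreover have "{y. x - y \<in> N} \<in> sets lborel"
  proof -
    have "closed ((\<lambda>y. x - y) -` N)" by (intro closed_vimage N(1) continuous_intros)
    then show ?thesis by (simp add: vimage_def borel_closed)
  qed
  ultimately have "{y. x - y \<in> N} \<in> null_sets lborel" by (simp add: null_sets_completion_iff)
  then have "AE y in lborel. y \<notin> {y. x - y \<in> N}" by (rule AE_not_in)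
  then have "AE y in lborel. (\<lambda>n. u y * v (X n - y)) \<longlonglongrightarrow> u y * v (x - y)"
  proof eventually_elim
    case (elim y)
    then have "isCont v (x - y)" using cont by simp
    moreover have "(\<lambda>n. X n - y) \<longlonglongrightarrow> x - y" by (intro tendsto_intros X)
    ultimately show ?case by (rule tendsto_mult[OF tendsto_const isCont_tendsto_compose])
  qed
  then have "(\<lambda>n. LINT y|lborel. u y * v (X n - y)) \<longlonglongrightarrow> (LINT y|lborel. u y * v (x - y))"
  proof (rule integral_dominated_convergence[rotated 3])
    show "integrable lborel (\<lambda>y. norm (u y) * C)" using u by simp
    show "AE y in lborel. norm (u y * v (X n - y)) \<le> norm (u y) * C" for n
      using bound by (auto simp: norm_mult intro!: mult_left_mono)
  qed measurable
  then show "((\<lambda>x. LINT y|lborel. u y * v (x - y)) \<circ> X) \<longlonglongrightarrow> (LINT y|lborel. u y * v (x - y))"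
    by (simp add: o_def)
qed

section \<open>Bessel's inequality\<close>

lemma integrable_bounded_cbox:
  fixes w :: "'a :: euclidean_space \<Rightarrow> 'b :: {banach, second_countable_topology}"
  assumes "w \<in> borel_measurable borel" and "\<And>p. norm (w p) \<le> C" and "\<And>p. p \<notin> cbox l r \<Longrightarrow> w p = 0"
  shows "integrable lborel w"
proof (rule Bochner_Integration.integrable_bound)
  show "integrable lborel (\<lambda>p. C * indicator (cbox l r) p :: real)"
    by (intro integrable_mult_right integrable_real_indicator) (auto simp: emeasure_lborel_cbox_eq)
  show "AE p in lborel. norm (w p) \<le> norm (C * indicator (cbox l r) p :: real)"
    using assms(2,3) by (intro AE_I2) (fastforce simp: indicator_def intro: order_trans)
qed (use assms(1) in simp)

text \<open>
  Expand the integral of \<open>\<bar>A u - s\<bar>\<^sup>2 \<ge> 0\<close>, where \<open>A = 4 a\<^sup>2\<close> is the area of the square and \<open>s / A\<close> is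
  the orthogonal projection of \<open>u\<close> to the span of the exponentials with frequencies in \<open>K\<close>.
\<close>

lemma fourier_bessel_inequality:
  fixes u :: "real \<times> real \<Rightarrow> complex"
  assumes "a > 0" and [measurable]: "u \<in> borel_measurable borel"
    and bound: "\<And>p. norm (u p) \<le> C" and supp: "\<And>p. p \<notin> cbox (- a, - a) (a, a) \<Longrightarrow> u p = 0"
    and "finite K"
  shows "(\<Sum>k\<in>K. (norm (LINT p|lborel. u p * fourier_char a (- k) p))\<^sup>2)
         \<le> 4 * a\<^sup>2 * (LINT p|lborel. (norm (u p))\<^sup>2)"
proof -
  let ?Q = "cbox (- a, - a) (a, a)"
  define A where "A = 4 * a\<^sup>2"
  have "A > 0" using \<open>a > 0\<close> by (simp add: A_def)
  define U where "U k = (LINT p|lborel. u p * fourier_char a (- k) p)" for k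
  have char_meas [measurable]: "fourier_char a k \<in> borel_measurable borel" for k
    by (intro borel_measurable_continuous_onI continuous_intros)
  have char_int: "integrable lborel (\<lambda>p. indicator ?Q p *\<^sub>R fourier_char a k p)"
    "(LINT p|lborel. indicator ?Q p *\<^sub>R fourier_char a k p) = (if k = 0 then of_real A else 0)" for k
  proof -
    have cont: "continuous_on ?Q (fourier_char a k)" by (intro continuous_intros)
    show "integrable lborel (\<lambda>p. indicator ?Q p *\<^sub>R fourier_char a k p)"
      by (rule borel_integrable_compact[OF compact_cbox cont])
    show "(LINT p|lborel. indicator ?Q p *\<^sub>R fourier_char a k p) = (if k = 0 then of_real A else 0)"
      using set_integrable_compact_continuous(2)[OF compact_cbox cont] integral_fourier_char[OF \<open>a > 0\<close>, of k]
      by (simp only: set_lebesgue_integral_def A_def)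
  qed
  have u_int: "integrable lborel (\<lambda>p. u p * fourier_char a k p)" for k
    by (rule integrable_bounded_cbox[where C = C and l = "(- a, - a)" and r = "(a, a)"])
       (use bound supp in \<open>auto simp: norm_mult\<close>)
  \<comment> \<open>The exponentials have squared norm \<open>A\<close>, so \<open>s\<close> is \<open>A\<close> times the projection of \<open>u\<close>.\<close>
  define s where "s p = (\<Sum>k\<in>K. U k * (indicator ?Q p *\<^sub>R fourier_char a k p))" for p
  have us: "integrable lborel (\<lambda>p. u p * cnj (s p))"
    "(LINT p|lborel. u p * cnj (s p)) = of_real (\<Sum>k\<in>K. (norm (U k))\<^sup>2)"
  proof -
    have eq: "u p * cnj (s p) = (\<Sum>k\<in>K. cnj (U k) * (u p * fourier_char a (- k) p))" for p
    proof (cases "p \<in> ?Q")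
      case True
      then show ?thesis by (simp add: s_def sum_distrib_left cnj_fourier_char mult_ac)
    next
      case False
      then show ?thesis by (simp add: supp)
    qed
    show "integrable lborel (\<lambda>p. u p * cnj (s p))"
      unfolding eq by (intro Bochner_Integration.integrable_sum integrable_mult_right u_int)
    have "(LINT p|lborel. u p * cnj (s p)) = (\<Sum>k\<in>K. cnj (U k) * U k)"
      unfolding eq using u_int by (subst Bochner_Integration.integral_sum) (auto simp: U_def)
    then show "(LINT p|lborel. u p * cnj (s p)) = of_real (\<Sum>k\<in>K. (norm (U k))\<^sup>2)"
      by (simp only: of_real_sum complex_norm_square mult.commute)
  qed
  have ss: "integrable lborel (\<lambda>p. s p * cnj (s p))"
    "(LINT p|lborel. s p * cnj (s p)) = of_real (A * (\<Sum>k\<in>K. (norm (U k))\<^sup>2))"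
  proof -
    have eq: "s p * cnj (s p) = (\<Sum>k\<in>K. \<Sum>l\<in>K. (U k * cnj (U l)) * (indicator ?Q p *\<^sub>R fourier_char a (k - l) p))" for p
    proof (cases "p \<in> ?Q")
      case True
      have "fourier_char a k p * cnj (fourier_char a l p) = fourier_char a (k - l) p" for k l
        by (simp add: cnj_fourier_char fourier_char_mult)
      with True show ?thesis
        by (simp add: s_def sum_product) (intro sum.cong refl, metis (no_types) mult.assoc mult.left_commute)
    next
      case False
      then show ?thesis by (simp add: s_def)
    qed
    show "integrable lborel (\<lambda>p. s p * cnj (s p))"
      unfolding eq by (intro Bochner_Integration.integrable_sum integrable_mult_right char_int)
    have "(LINT p|lborel. s p * cnj (s p))
        = (\<Sum>k\<in>K. \<Sum>l\<in>K. (U k * cnj (U l)) * (if k - l = 0 then of_real A else 0))"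
      unfolding eq
      by (subst Bochner_Integration.integral_sum,
          intro Bochner_Integration.integrable_sum integrable_mult_right char_int,
          intro sum.cong refl, subst Bochner_Integration.integral_sum,
          intro integrable_mult_right char_int, simp only: integral_mult_right_zero char_int)
    also have "\<dots> = (\<Sum>k\<in>K. (U k * cnj (U k)) * of_real A)"
    proof (intro sum.cong refl)
      fix k assume "k \<in> K"
      have "(\<Sum>l\<in>K. (U k * cnj (U l)) * (if k - l = 0 then of_real A else 0))
          = (\<Sum>l\<in>K. if l = k then (U k * cnj (U k)) * of_real A else 0)"
        by (intro sum.cong) auto
      then show "(\<Sum>l\<in>K. (U k * cnj (U l)) * (if k - l = 0 then of_real A else 0)) = (U k * cnj (U k)) * of_real A"
        using \<open>k \<in> K\<close> \<open>finite K\<close> by simp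
    qed
    also have "\<dots> = of_real (A * (\<Sum>k\<in>K. (norm (U k))\<^sup>2))"
      by (simp only: of_real_mult of_real_sum complex_norm_square sum_distrib_left mult.commute)
    finally show "(LINT p|lborel. s p * cnj (s p)) = of_real (A * (\<Sum>k\<in>K. (norm (U k))\<^sup>2))" .
  qed
  have uu: "integrable lborel (\<lambda>p. (norm (u p))\<^sup>2)"
  proof (rule integrable_bounded_cbox[where C = "C\<^sup>2" and l = "(- a, - a)" and r = "(a, a)"])
    show "norm ((norm (u p))\<^sup>2) \<le> C\<^sup>2" for p using bound[of p] by (simp add: power_mono)
  qed (use supp in simp_all)
  have expand: "(norm (of_real A * u p - s p))\<^sup>2
      = A\<^sup>2 * (norm (u p))\<^sup>2 - 2 * A * Re (u p * cnj (s p)) + Re (s p * cnj (s p))" for p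
    unfolding cmod_power2 by (simp add: power2_eq_square algebra_simps)
  have "0 \<le> (LINT p|lborel. (norm (of_real A * u p - s p))\<^sup>2)" by (rule Bochner_Integration.integral_nonneg) simp
  also have "\<dots> = A\<^sup>2 * (LINT p|lborel. (norm (u p))\<^sup>2) - 2 * A * Re (LINT p|lborel. u p * cnj (s p))
      + Re (LINT p|lborel. s p * cnj (s p))"
  proof -
    have linear: "(LINT p|lborel. \<alpha> * f p - \<beta> * g p + h p)
        = \<alpha> * (LINT p|lborel. f p) - \<beta> * (LINT p|lborel. g p) + (LINT p|lborel. h p)"
      if "integrable lborel f" "integrable lborel g" "integrable lborel h"
      for \<alpha> \<beta> :: real and f g h :: "real \<times> real \<Rightarrow> real"
      using that by simp
    have "integrable lborel (\<lambda>p. Re (u p * cnj (s p)))" "integrable lborel (\<lambda>p. Re (s p * cnj (s p)))"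
      using us(1) ss(1) by (simp_all only: integrable_Re)
    then have "(LINT p|lborel. (norm (of_real A * u p - s p))\<^sup>2)
      = A\<^sup>2 * (LINT p|lborel. (norm (u p))\<^sup>2) - 2 * A * (LINT p|lborel. Re (u p * cnj (s p)))
      + (LINT p|lborel. Re (s p * cnj (s p)))"
      unfolding expand by (intro linear uu)
    then show ?thesis
      using us(1) ss(1) by (simp only: integral_Re)
  qed
  also have "\<dots> = A * (A * (LINT p|lborel. (norm (u p))\<^sup>2) - (\<Sum>k\<in>K. (norm (U k))\<^sup>2))"
    unfolding us(2) ss(2) Re_complex_of_real by (simp add: power2_eq_square algebra_simps)
  finally have "0 \<le> A * (LINT p|lborel. (norm (u p))\<^sup>2) - (\<Sum>k\<in>K. (norm (U k))\<^sup>2)"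
    using \<open>A > 0\<close> by (simp only: zero_le_mult_iff) auto
  then show ?thesis by (simp add: A_def U_def)
qed

text \<open>
  By Bessel's inequality both families of coefficients are square summable.
\<close>

lemma fourier_coeff_product_summable:
  fixes u v :: "real \<times> real \<Rightarrow> complex"
  assumes "a > 0" and "u \<in> borel_measurable borel" "v \<in> borel_measurable borel"
    and "\<And>p. norm (u p) \<le> C" "\<And>p. norm (v p) \<le> C"
    and "\<And>p. p \<notin> cbox (- a, - a) (a, a) \<Longrightarrow> u p = 0" "\<And>p. p \<notin> cbox (- a, - a) (a, a) \<Longrightarrow> v p = 0"
  shows "(\<lambda>k. norm ((LINT p|lborel. u p * fourier_char a (- k) p)
                    * (LINT p|lborel. v p * fourier_char a (- k) p))) summable_on UNIV"
proof (rule nonneg_bdd_above_summable_on)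
  define U where "U w k = (LINT p|lborel. w p * fourier_char a (- k) p)" for w k
  define B where "B w = 4 * a\<^sup>2 * (LINT p|lborel. (norm (w p))\<^sup>2)" for w :: "real \<times> real \<Rightarrow> complex"
  have bessel: "(\<Sum>k\<in>K. (norm (U u k))\<^sup>2) \<le> B u" "(\<Sum>k\<in>K. (norm (U v k))\<^sup>2) \<le> B v" if "finite K" for K
    unfolding U_def B_def
    by (rule fourier_bessel_inequality[OF assms(1,2,4,6) that] fourier_bessel_inequality[OF assms(1,3,5,7) that]; assumption)+
  have "(\<Sum>k\<in>K. norm (U u k * U v k)) \<le> B u + B v" if "finite K" for K
  proof -
    have "norm (U u k * U v k) \<le> (norm (U u k))\<^sup>2 + (norm (U v k))\<^sup>2" for k
    proof -
      have "2 * (norm (U u k) * norm (U v k)) \<le> (norm (U u k))\<^sup>2 + (norm (U v k))\<^sup>2"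
        using sum_squares_bound[of "norm (U u k)" "norm (U v k)"] by simp
      moreover have "0 \<le> norm (U u k) * norm (U v k)" by simp
      ultimately show ?thesis unfolding norm_mult by linarith
    qed
    then have "(\<Sum>k\<in>K. norm (U u k * U v k)) \<le> (\<Sum>k\<in>K. (norm (U u k))\<^sup>2 + (norm (U v k))\<^sup>2)"
      by (intro sum_mono)
    also have "\<dots> \<le> B u + B v" using bessel[OF that] by (simp add: sum.distrib)
    finally show ?thesis .
  qed
  then show "bdd_above (sum (\<lambda>k. norm ((LINT p|lborel. u p * fourier_char a (- k) p)
                    * (LINT p|lborel. v p * fourier_char a (- k) p))) ` {F. F \<subseteq> UNIV \<and> finite F})"
    unfolding U_def by (intro bdd_aboveI[of _ "B u + B v"]) blast
qed simp

section \<open>The windowed convolution and its Fourier series\<close>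

lemma abs_fst_snd_le_norm:
  fixes p :: "real \<times> real"
  shows "\<bar>fst p\<bar> \<le> norm p" "\<bar>snd p\<bar> \<le> norm p"
  using norm_fst_le[of "fst p" "snd p"] norm_snd_le[of "snd p" "fst p"] by auto

lemma borel_measurable_extend_by_zero [measurable]:
  assumes "continuous_on UNIV f"
  shows "extend_by_zero b f \<in> borel_measurable borel"
proof -
  have [measurable]: "f \<in> borel_measurable borel" using assms by (rule borel_measurable_continuous_onI)
  have [measurable]: "cball 0 b \<in> sets borel" by (simp add: borel_closed)
  show ?thesis unfolding extend_by_zero_def by measurable
qed

lemma extend_by_zero_bounded:
  assumes "continuous_on UNIV f"
  obtains C where "\<And>x. norm (extend_by_zero b f x) \<le> C"
proof -
  have "compact (f ` cball 0 b)"
    using assms by (intro compact_continuous_image continuous_on_subset[OF assms]) auto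
  then obtain C where C: "\<And>x. x \<in> cball 0 b \<Longrightarrow> norm (f x) \<le> C"
    by (metis bounded_iff compact_imp_bounded imageI)
  have "norm (extend_by_zero b f x) \<le> max C 0" for x
    using C[of x] by (auto simp: extend_by_zero_def)
  then show ?thesis by (rule that)
qed

lemma isCont_extend_by_zero:
  assumes "continuous_on UNIV f" and x: "x \<notin> sphere 0 b"
  shows "isCont (extend_by_zero b f) x"
proof (cases "x \<in> ball 0 b")
  case True
  have "isCont f x" using assms(1) by (simp add: continuous_on_eq_continuous_at)
  moreover have "eventually (\<lambda>y. extend_by_zero b f y = f y) (nhds x)"
    using eventually_nhds_in_open[OF open_ball True] by eventually_elim (simp add: extend_by_zero_def)
  ultimately show ?thesis by (simp add: isCont_cong)
next
  case False
  then have "x \<in> - cball 0 b" using x by auto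
  then have "eventually (\<lambda>y. extend_by_zero b f y = 0) (nhds x)"
    by (rule eventually_mono[OF eventually_nhds_in_open[OF open_Compl[OF closed_cball]]])
       (simp add: extend_by_zero_def)
  then have "isCont (extend_by_zero b f) x \<longleftrightarrow> isCont (\<lambda>_. 0 :: complex) x" by (rule isCont_cong)
  then show ?thesis by simp
qed

lemma isCont_vec2: "isCont vec2 p"
  using continuous_on_vec2[OF continuous_on_id, of UNIV] unfolding continuous_on_eq_continuous_at[OF open_UNIV] by blast

lemma windowed_fourier_eq_integral:
  assumes f: "continuous_on UNIV f"
  shows "windowed_fourier a b f k
       = (LINT p|lborel. extend_by_zero b f (vec2 p) * fourier_char a (- k) p)"
proof -
  define F where "F v = f v * fourier_char a (- k) (v $ 1, v $ 2)" for v
  have F: "continuous_on UNIV F" unfolding F_def by (intro continuous_intros f)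
  have "exp (- of_real pi * \<i> * of_real (inverse a) * of_real r
           * of_real (of_int (fst k) * cos \<theta> + of_int (snd k) * sin \<theta>))
        = fourier_char a (- k) (polar r \<theta> $ 1, polar r \<theta> $ 2)" for r \<theta>
  proof -
    have "pi / a * (of_int (fst (- k)) * (r * cos \<theta>) + of_int (snd (- k)) * (r * sin \<theta>))
        = - (pi * inverse a * r * (of_int (fst k) * cos \<theta> + of_int (snd k) * sin \<theta>))"
      by (simp add: divide_inverse algebra_simps)
    then show ?thesis
      by (simp only: fourier_char_def polar_def vector_2 fst_conv snd_conv) (simp add: cis_conv_exp mult_ac)
  qed
  then have "windowed_fourier a b f k
      = (LBINT r:{0..b}. (LBINT \<theta>:{0..2 * pi}. F (polar r \<theta>) * of_real r))"
    by (simp only: windowed_fourier_def F_def)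
  also have "\<dots> = integral (cbox (0, 0) (b, 2 * pi)) (\<lambda>x. F (polar (fst x) (snd x)) * of_real (fst x))"
  proof -
    have "continuous_on (cbox (0, 0) (b, 2 * pi)) (\<lambda>x. F (polar (fst x) (snd x)) * of_real (fst x))"
      by (intro continuous_intros continuous_on_compose2[OF F]) auto
    from iterated_set_integral_eq_integral_cbox[OF this] show ?thesis by simp
  qed
  also have "\<dots> = (LINT p|lborel. indicator (cball 0 b) p *\<^sub>R F (vec2 p))"
    by (rule integral_polar_coordinates[OF F])
  also have "\<dots> = (LINT p|lborel. extend_by_zero b f (vec2 p) * fourier_char a (- k) p)"
    by (intro Bochner_Integration.integral_cong) (auto simp: extend_by_zero_def F_def indicator_def)
  finally show ?thesis .
qed

lemma windowed_convolution_vec2: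
  assumes f1: "continuous_on UNIV f1" and f2: "continuous_on UNIV f2"
  shows "windowed_convolution b f1 f2 (vec2 p)
       = (LINT q|lborel. extend_by_zero b f1 (vec2 q) * extend_by_zero b f2 (vec2 (p - q)))"
proof -
  note [measurable] = borel_measurable_extend_by_zero[OF f1] borel_measurable_extend_by_zero[OF f2]
  show ?thesis
    unfolding windowed_convolution_def convolution_def
    by (subst integral_lborel_vec2) (auto simp: vec2_diff)
qed

lemma continuous_on_windowed_convolution:
  assumes f1: "continuous_on UNIV f1" and f2: "continuous_on UNIV f2"
  shows "continuous_on UNIV (\<lambda>p. windowed_convolution b f1 f2 (vec2 p))"
proof -
  note [measurable] = borel_measurable_extend_by_zero[OF f1] borel_measurable_extend_by_zero[OF f2]
  obtain C where C: "\<And>x. norm (extend_by_zero b f1 x) \<le> C" using extend_by_zero_bounded[OF f1] by blast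
  obtain D where D: "\<And>x. norm (extend_by_zero b f2 x) \<le> D" using extend_by_zero_bounded[OF f2] by blast
  show ?thesis
    unfolding windowed_convolution_vec2[OF assms]
  proof (rule continuous_on_convolution[where C = D and N = "sphere 0 b"])
    show "integrable lborel (\<lambda>p. extend_by_zero b f1 (vec2 p))"
    proof (rule integrable_bounded_cbox)
      show "extend_by_zero b f1 (vec2 p) = 0" if p: "p \<notin> cbox (- b, - b) (b, b)" for p
      proof -
        have "\<not> norm p \<le> b"
          using p abs_fst_snd_le_norm[of p] by (cases p) (auto simp: cbox_Pair_eq)
        then show ?thesis by (simp add: extend_by_zero_def)
      qed
      show "norm (extend_by_zero b f1 (vec2 p)) \<le> C" for p by (rule C)
    qed measurable
    show "(\<lambda>p. extend_by_zero b f2 (vec2 p)) \<in> borel_measurable borel" by measurable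
    show "norm (extend_by_zero b f2 (vec2 p)) \<le> D" for p by (rule D)
    show "negligible (sphere 0 b :: (real \<times> real) set)" by (rule negligible_sphere)
    show "isCont (\<lambda>p. extend_by_zero b f2 (vec2 p)) p" if "p \<notin> sphere 0 b" for p
      using that by (intro isCont_o2[OF isCont_vec2] isCont_extend_by_zero f2) simp
  qed simp
qed

text \<open>
  Strictly outside the disc the two windows in the integrand do not overlap. On the bounding circle
  they touch in one point, and the value is zero by continuity.
\<close>

lemma windowed_convolution_eq_0:
  assumes f1: "continuous_on UNIV f1" and f2: "continuous_on UNIV f2" and "norm p \<ge> 2 * b"
  shows "windowed_convolution b f1 f2 (vec2 p) = 0"
proof (rule continuous_constant_on_closure[of "- cball 0 (2 * b)" "\<lambda>p. windowed_convolution b f1 f2 (vec2 p)"])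
  show "continuous_on (closure (- cball 0 (2 * b))) (\<lambda>p. windowed_convolution b f1 f2 (vec2 p))"
    using continuous_on_windowed_convolution[OF f1 f2] by (rule continuous_on_subset) simp
  show "p \<in> closure (- cball 0 (2 * b))" using assms(3) by (simp add: closure_complement)
  show "windowed_convolution b f1 f2 (vec2 x) = 0" if "x \<in> - cball 0 (2 * b)" for x
  proof -
    have "extend_by_zero b f1 (vec2 q) * extend_by_zero b f2 (vec2 (x - q)) = 0" for q
    proof -
      have "norm x \<le> norm q + norm (x - q)" using norm_triangle_ineq[of q "x - q"] by simp
      then have "\<not> (norm q \<le> b \<and> norm (x - q) \<le> b)" using that by auto
      then show ?thesis by (auto simp: extend_by_zero_def)
    qed
    then show ?thesis
      unfolding windowed_convolution_vec2[OF f1 f2] by (simp only: Bochner_Integration.integral_zero)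
  qed
qed

lemma cis_eq_imp_boundary:
  fixes x y :: real
  assumes "a > 0" and "\<bar>x\<bar> \<le> a" "\<bar>y\<bar> \<le> a" and "cis (pi / a * x) = cis (pi / a * y)" and "x \<noteq> y"
  shows "\<bar>x\<bar> = a \<and> \<bar>y\<bar> = a"
proof -
  have "sin (pi / a * x) = sin (pi / a * y) \<and> cos (pi / a * x) = cos (pi / a * y)"
    using assms(4) by (simp add: complex_eq_iff)
  then obtain n :: int where "pi / a * x = pi / a * y + 2 * pi * n"
    using sin_cos_eq_iff by blast
  then have "pi * x = pi * (y + 2 * a * n)" using \<open>a > 0\<close> by (simp add: field_simps)
  then have n: "x = y + 2 * a * n" by simp
  then have "n \<noteq> 0" using \<open>x \<noteq> y\<close> by auto
  then consider "real_of_int n \<ge> 1" | "real_of_int n \<le> - 1" by linarith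
  then show ?thesis
  proof cases
    case 1
    then have "a * n \<ge> a * 1" using \<open>a > 0\<close> by (intro mult_left_mono) auto
    then show ?thesis using n assms(2,3) by linarith
  next
    case 2
    then have "a * n \<le> a * - 1" using \<open>a > 0\<close> by (intro mult_left_mono) auto
    then show ?thesis using n assms(2,3) by linarith
  qed
qed

text \<open>
  Distinct points of the square that are identified in the torus lie on its boundary, where the
  convolution vanishes.
\<close>

lemma windowed_convolution_periodic:
  assumes f: "continuous_on UNIV f1" "continuous_on UNIV f2" and "a > 0" "b = a / 2"
    and p: "p \<in> cbox (- a, - a) (a, a)" and q: "q \<in> cbox (- a, - a) (a, a)"
    and eq: "torus_map a p = torus_map a q"
  shows "windowed_convolution b f1 f2 (vec2 p) = windowed_convolution b f1 f2 (vec2 q)"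
proof (cases "p = q")
  case False
  have bounds: "\<bar>fst p\<bar> \<le> a" "\<bar>fst q\<bar> \<le> a" "\<bar>snd p\<bar> \<le> a" "\<bar>snd q\<bar> \<le> a"
    using p q by (cases p; cases q; auto simp: cbox_Pair_eq)+
  have "fst p \<noteq> fst q \<or> snd p \<noteq> snd q" using False by (simp add: prod_eq_iff)
  then have "(\<bar>fst p\<bar> = a \<and> \<bar>fst q\<bar> = a) \<or> (\<bar>snd p\<bar> = a \<and> \<bar>snd q\<bar> = a)"
    using eq bounds cis_eq_imp_boundary[OF \<open>a > 0\<close>] by (auto simp: torus_map_def)
  then have "norm p \<ge> 2 * b" "norm q \<ge> 2 * b"
    using abs_fst_snd_le_norm[of p] abs_fst_snd_le_norm[of q] \<open>b = a / 2\<close> by linarith+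
  then show ?thesis using windowed_convolution_eq_0[OF f] by simp
qed simp

lemma windowed_convolution_fourier_series:
  assumes f1: "continuous_on UNIV f1" and f2: "continuous_on UNIV f2" and "a > 0" "b = a / 2"
  defines "c \<equiv> \<lambda>k. windowed_fourier a b f1 k * windowed_fourier a b f2 k / of_real (4 * a\<^sup>2)"
  shows "(\<lambda>k. norm (c k)) summable_on UNIV"
    and "p \<in> cbox (- a, - a) (a, a) \<Longrightarrow>
           windowed_convolution b f1 f2 (vec2 p) = (\<Sum>\<^sub>\<infinity>k. c k * fourier_char a k p)"
proof -
  let ?Q = "cbox (- a, - a) (a, a)"
  define E1 where "E1 p = extend_by_zero b f1 (vec2 p)" for p
  define E2 where "E2 p = extend_by_zero b f2 (vec2 p)" for p
  define h where "h p = windowed_convolution b f1 f2 (vec2 p)" for p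
  note [measurable] = borel_measurable_extend_by_zero[OF f1] borel_measurable_extend_by_zero[OF f2]
  have meas [measurable]: "E1 \<in> borel_measurable borel" "E2 \<in> borel_measurable borel"
    unfolding E1_def E2_def by measurable
  have norm_outside: "norm p > a" if "p \<notin> ?Q" for p :: "real \<times> real"
  proof -
    show ?thesis using that abs_fst_snd_le_norm[of p] by (cases p) (auto simp: cbox_Pair_eq)
  qed
  have supp: "E1 p = 0" "E2 p = 0" if "p \<notin> ?Q" for p
    using norm_outside[OF that] \<open>a > 0\<close> \<open>b = a / 2\<close> by (auto simp: E1_def E2_def extend_by_zero_def)
  obtain C1 where C1: "\<And>x. norm (extend_by_zero b f1 x) \<le> C1" using extend_by_zero_bounded[OF f1] by blast
  obtain C2 where C2: "\<And>x. norm (extend_by_zero b f2 x) \<le> C2" using extend_by_zero_bounded[OF f2] by blast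
  have bound: "norm (E1 p) \<le> max C1 C2" "norm (E2 p) \<le> max C1 C2" for p
    unfolding E1_def E2_def by (rule max.coboundedI1[OF C1], rule max.coboundedI2[OF C2])
  have int: "integrable lborel E1" "integrable lborel E2"
    by (rule integrable_bounded_cbox[OF meas(1) bound(1) supp(1)], simp)
       (rule integrable_bounded_cbox[OF meas(2) bound(2) supp(2)], simp)
  have wf: "windowed_fourier a b f1 k = (LINT p|lborel. E1 p * fourier_char a (- k) p)"
    "windowed_fourier a b f2 k = (LINT p|lborel. E2 p * fourier_char a (- k) p)" for k
    unfolding E1_def E2_def by (rule windowed_fourier_eq_integral[OF f1] windowed_fourier_eq_integral[OF f2])+
  have "(\<lambda>k. norm (windowed_fourier a b f1 k * windowed_fourier a b f2 k)) summable_on UNIV"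
    unfolding wf using fourier_coeff_product_summable[OF \<open>a > 0\<close> meas bound supp] .
  then have "(\<lambda>k. norm (windowed_fourier a b f1 k * windowed_fourier a b f2 k) * (1 / (4 * a\<^sup>2))) summable_on UNIV"
    by (rule summable_on_cmult_left)
  then show sum_c: "(\<lambda>k. norm (c k)) summable_on UNIV"
    by (simp add: c_def norm_divide norm_mult norm_power)
  have h: "h p = (LINT q|lborel. E1 q * E2 (p - q))" for p
    unfolding h_def E1_def E2_def by (rule windowed_convolution_vec2[OF f1 f2])
  have cont_h: "continuous_on S h" for S
    unfolding h_def by (rule continuous_on_subset[OF continuous_on_windowed_convolution[OF f1 f2]]) simp
  have h_outside: "h p = 0" if "p \<notin> ?Q" for p
    unfolding h_def using norm_outside[OF that] \<open>b = a / 2\<close> by (intro windowed_convolution_eq_0[OF f1 f2]) simp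
  \<comment> \<open>Since \<open>h\<close> vanishes outside the square, its coefficients are integrals over the plane.\<close>
  have coeff: "integral ?Q (\<lambda>p. h p * fourier_char a (- k) p) = of_real (4 * a\<^sup>2) * c k" for k
  proof -
    have "integral ?Q (\<lambda>p. h p * fourier_char a (- k) p)
        = (LINT p|lborel. indicator ?Q p *\<^sub>R (h p * fourier_char a (- k) p))"
      unfolding set_lebesgue_integral_def[symmetric]
      by (intro set_integrable_compact_continuous(2)[symmetric] continuous_intros cont_h) auto
    also have "\<dots> = (LINT p|lborel. h p * fourier_char a (- k) p)"
      using h_outside by (intro Bochner_Integration.integral_cong) (auto simp: indicator_def)
    also have "\<dots> = (LINT p|lborel. E1 p * fourier_char a (- k) p) * (LINT p|lborel. E2 p * fourier_char a (- k) p)"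
      unfolding h
      by (rule convolution_times_character[OF int])
         (auto simp: fourier_char_add intro!: borel_measurable_continuous_onI continuous_intros)
    finally show ?thesis using \<open>a > 0\<close> by (simp add: c_def wf)
  qed
  show "windowed_convolution b f1 f2 (vec2 p) = (\<Sum>\<^sub>\<infinity>k. c k * fourier_char a k p)" if "p \<in> ?Q"
  proof -
    have "h p = h q" if "p \<in> ?Q" "q \<in> ?Q" "torus_map a p = torus_map a q" for p q
      unfolding h_def using windowed_convolution_periodic[OF f1 f2 assms(3,4) that] .
    from fourier_series_of_summable_coeffs[OF \<open>a > 0\<close> cont_h this coeff sum_c that]
    show ?thesis unfolding h_def .
  qed
qed

section \<open>Zernike coefficients of the windowed convolution\<close>

lemma fourier_char_polar:
  "fourier_char a k (r * cos \<theta>, r * sin \<theta>) = cis (pi / a * r * lattice_norm k * cos (\<theta> - lattice_angle k))"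
proof -
  define z where "z = Complex (of_int (fst k)) (of_int (snd k))"
  have "lattice_norm k = cmod z" by (simp add: lattice_norm_def z_def cmod_def)
  then have k: "lattice_norm k * cos (lattice_angle k) = of_int (fst k)"
    "lattice_norm k * sin (lattice_angle k) = of_int (snd k)"
    using cos_Arg2pi[of z] sin_Arg2pi[of z] by (simp_all add: lattice_angle_def z_def)
  have "pi / a * (of_int (fst k) * (r * cos \<theta>) + of_int (snd k) * (r * sin \<theta>))
      = pi / a * r * lattice_norm k * cos (\<theta> - lattice_angle k)"
    unfolding k[symmetric] cos_diff by (simp add: algebra_simps)
  then show ?thesis by (simp only: fourier_char_def fst_conv snd_conv)
qed

text \<open>
  The expansion of the plane wave produces the power \<open>\<i> ^ n\<close>, the unimodular constant of
  \<^const>\<open>c_coeff\<close> in a form that does not mention \<open>m\<close>.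
\<close>

lemma i_powi_times_sign:
  assumes "even (int n - m)"
  shows "\<i> powi m * (- 1) powi ((int n - m) div 2) = \<i> ^ n"
proof -
  have "(- 1) powi ((int n - m) div 2) = (\<i> powi 2) powi ((int n - m) div 2)" by simp
  also have "\<dots> = \<i> powi (int n - m)"
    using assms by (simp only: power_int_mult[symmetric] even_two_times_div_two)
  finally have "\<i> powi m * (- 1) powi ((int n - m) div 2) = \<i> powi (m + (int n - m))"
    by (simp only:) (rule power_int_add[symmetric], simp)
  then show ?thesis by simp
qed

lemma integral_fourier_char_zernike:
  assumes "a > 0" and m: "\<bar>m\<bar> \<le> int n" "even (int n - \<bar>m\<bar>)"
  shows "integral (cbox (0, 0) (a, 2 * pi)) (\<lambda>x. fourier_char a k (fst x * cos (snd x), fst x * sin (snd x))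
            * (cnj (zernike a n m (fst x) (snd x)) * of_real (fst x)))
      = of_real (4 * a\<^sup>2) * c_coeff a k n m"
proof -
  have "even (int n - m)" using m(2) by auto
  have "of_real (4 * a\<^sup>2) * c_coeff a k n m
      = of_real (4 * a\<^sup>2 * sqrt (real n + 1) / (2 * a * sqrt pi)) * (\<i> powi m * (- 1) powi ((int n - m) div 2))
        * cis (- (of_int m * lattice_angle k)) * of_real (bessel_quotient n (lattice_norm k))"
    by (simp add: c_coeff_def cis_conv_exp mult_ac)
  also have "4 * a\<^sup>2 * sqrt (real n + 1) / (2 * a * sqrt pi) = 2 * a * sqrt ((real n + 1) / pi)"
    using \<open>a > 0\<close> by (simp add: real_sqrt_divide power2_eq_square)
  finally show ?thesis
    unfolding fourier_char_polar integral_plane_wave_zernike[OF assms] i_powi_times_sign[OF \<open>even (int n - m)\<close>]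
    by simp
qed

theorem theorem4p5:
  fixes a b :: real and f1 f2 :: "real ^ 2 \<Rightarrow> complex" and n :: nat and m :: int
  assumes "a > 0" and "b = a / 2"
    and "continuous_on UNIV f1" and "integrable lborel f1"
    and "continuous_on UNIV f2" and "integrable lborel f2"
    and "\<bar>m\<bar> \<le> int n" and "even (int n - \<bar>m\<bar>)"
  shows "((\<lambda>k. c_coeff a k n m * windowed_fourier a b f1 k * windowed_fourier a b f2 k)
           has_sum zernike_coeff a n m (windowed_convolution b f1 f2)) (UNIV :: (int \<times> int) set)"
proof -
  let ?D = "cbox (0, 0) (a, 2 * pi) :: (real \<times> real) set"
  define c where "c k = windowed_fourier a b f1 k * windowed_fourier a b f2 k / of_real (4 * a\<^sup>2)" for k
  define w where "w x = cnj (zernike a n m (fst x) (snd x)) * complex_of_real (fst x)" for x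
  define P :: "real \<times> real \<Rightarrow> real \<times> real" where "P x = (fst x * cos (snd x), fst x * sin (snd x))" for x
  define h where "h p = windowed_convolution b f1 f2 (vec2 p)" for p
  note series = windowed_convolution_fourier_series[OF assms(3,5,1,2), folded c_def h_def]
  have w: "continuous_on ?D w"
    unfolding w_def cnj_zernike by (intro continuous_intros)
  have P: "continuous_on S P" for S unfolding P_def by (intro continuous_intros)
  have P_in: "P x \<in> cbox (- a, - a) (a, a)" if "x \<in> ?D" for x
  proof -
    have "\<bar>fst x\<bar> \<le> a" using that by (cases x) (auto simp: cbox_Pair_eq)
    then have "\<bar>fst x\<bar> * \<bar>cos (snd x)\<bar> \<le> a * 1" "\<bar>fst x\<bar> * \<bar>sin (snd x)\<bar> \<le> a * 1"
      by (intro mult_mono; simp)+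
    then show ?thesis by (simp add: P_def cbox_Pair_eq abs_le_iff flip: abs_mult)
  qed
  obtain W where W: "\<And>x. x \<in> ?D \<Longrightarrow> norm (w x) \<le> W"
    using compact_imp_bounded[OF compact_continuous_image[OF w compact_cbox]]
    by (auto simp: bounded_iff)
  have cont: "continuous_on ?D (\<lambda>x. h (P x) * w x)"
    unfolding h_def
    by (intro continuous_on_mult w continuous_on_compose2[OF continuous_on_windowed_convolution[OF assms(3,5)] P]) auto
  have "zernike_coeff a n m (windowed_convolution b f1 f2)
      = (LBINT r:{0..a}. (LBINT \<theta>:{0..2 * pi}. (\<lambda>x. h (P x) * w x) (r, \<theta>)))"
    by (simp add: zernike_coeff_def h_def P_def w_def polar_def vec2_def mult.assoc)
  also have "\<dots> = integral ?D (\<lambda>x. h (P x) * w x)"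
    by (rule iterated_set_integral_eq_integral_cbox[OF cont])
  also have "\<dots> = integral ?D (\<lambda>x. \<Sum>\<^sub>\<infinity>k. c k * fourier_char a k (P x) * w x)"
  proof (rule integral_cong)
    fix x assume "x \<in> ?D"
    then have "h (P x) = (\<Sum>\<^sub>\<infinity>k. c k * fourier_char a k (P x))" by (intro series(2) P_in)
    then show "h (P x) * w x = (\<Sum>\<^sub>\<infinity>k. c k * fourier_char a k (P x) * w x)"
      by (simp only: infsum_cmult_left')
  qed
  finally have coeff: "zernike_coeff a n m (windowed_convolution b f1 f2)
      = integral ?D (\<lambda>x. \<Sum>\<^sub>\<infinity>k. c k * fourier_char a k (P x) * w x)" .
  have "((\<lambda>k. integral ?D (\<lambda>x. c k * fourier_char a k (P x) * w x)) has_sum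
           integral ?D (\<lambda>x. \<Sum>\<^sub>\<infinity>k. c k * fourier_char a k (P x) * w x)) UNIV"
  proof (rule has_sum_integral_cbox(1))
    show "(\<lambda>k. norm (c k) * W) summable_on UNIV" using series(1) by (rule summable_on_cmult_left)
    show "norm (c k * fourier_char a k (P x) * w x) \<le> norm (c k) * W" if "x \<in> ?D" for k x
      using W[OF that] by (simp add: norm_mult mult_left_mono)
    show "continuous_on ?D (\<lambda>x. c k * fourier_char a k (P x) * w x)" for k
      by (intro continuous_intros w P)
  qed
  moreover have "integral ?D (\<lambda>x. c k * fourier_char a k (P x) * w x)
      = c_coeff a k n m * windowed_fourier a b f1 k * windowed_fourier a b f2 k" for k
  proof -
    have "integral ?D (\<lambda>x. c k * fourier_char a k (P x) * w x)
        = c k * integral ?D (\<lambda>x. fourier_char a k (P x) * w x)"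
      by (simp add: mult.assoc)
    also have "integral ?D (\<lambda>x. fourier_char a k (P x) * w x) = of_real (4 * a\<^sup>2) * c_coeff a k n m"
      unfolding P_def w_def by (rule integral_fourier_char_zernike[OF assms(1,7,8)])
    finally show ?thesis using \<open>a > 0\<close> by (simp add: c_def)
  qed
  ultimately show ?thesis unfolding coeff by simp
qed

end
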